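(* Let $\Gamma$ be a group and $\mathbb{G}=[\partial:G_1\to G_0]$ a $\Gamma$-crossed-module with a $\Gamma$-equivariant braiding. Then the first cohomology set $H^1(\Gamma,\mathbb{G})$ inherits a natural group structure (induced by the product on $Z^1(\Gamma,\mathbb{G})$), $H^0(\Gamma,\mathbb{G})$ is abelian, and there is a natural action of $H^1(\Gamma,\mathbb{G})$ on $H^0(\Gamma,\mathbb{G})$ (induced by the right action of $Z^1(\Gamma,\mathbb{G})$ on $C^0(\Gamma,\mathbb{G})$).
   Context: A crossed-module $\mathbb{G}=[\partial:G_1\to G_0]$ is a group homomorphism with a right action of $G_0$ on $G_1$ by automorphisms such that $\partial(\alpha^g)=g^{-1}\partial(\alpha)g$ and $\alpha^{\partial\beta}=\beta^{-1}\alpha\beta$. A $\Gamma$-crossed-module is one with left actions of $\Gamma$ on $G_0,G_1$ by automorphisms, with $\partial$ $\Gamma$-equivariant and ${}^{\sigma}(\alpha^g)=({}^{\sigma}\alpha)^{({}^{\sigma}g)}$. A braiding is a map $\{,\}:G_0\times G_0\to G_1$ with $\partial\{g,h\}=g^{-1}h^{-1}gh$; $\{\partial\alpha,g\}=\alpha^{-1}\alpha^g$; $\{g,\partial\alpha\}=(\alpha^{-1})^g\alpha$; $\{g,hk\}=\{g,k\}\{g,h\}^k$; $\{gh,k\}=\{g,k\}^h\{h,k\}$. It is $\Gamma$-equivariant if $\{{}^{\sigma}g,{}^{\sigma}h\}={}^{\sigma}\{g,h\}$. Pointed maps preserve identity elements. $C^0(\Gamma,\mathbb{G})$ is the set of pairs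 $(g,\theta)$, $g\in G_0$, $\theta:\Gamma\to G_1$ pointed. $Z^0(\Gamma,\mathbb{G})\subset C^0(\Gamma,\mathbb{G})$ is the subset of $(g,\theta)$ with $\partial\theta(\sigma)=g^{-1}\,{}^{\sigma}g$ and $\theta(\sigma\tau)=\theta(\sigma)\,{}^{\sigma}\theta(\tau)$; it is a group under $(g_1,\theta_1)(g_2,\theta_2)=(g_1g_2,\ \sigma\mapsto\theta_1(\sigma)^{g_2}\theta_2(\sigma))$. $B^0(\Gamma,\mathbb{G})$ is the normal subgroup of pairs $(\partial\mu,\ \sigma\mapsto\mu^{-1}\,{}^{\sigma}\mu)$, $\mu\in G_1$, and $H^0=Z^0/B^0$. $Z^1(\Gamma,\mathbb{G})$ is the set of pairs $(p,\varepsilon)$ of pointed maps $p:\Gamma\to G_0$, $\varepsilon:\Gamma\times\Gamma\to G_1$ with $p(\sigma\tau)\,\partial\varepsilon(\sigma,\tau)=p(\sigma)\,{}^{\sigma}p(\tau)$ and $\varepsilon(\sigma,\tau\upsilon)\,{}^{\sigma}\varepsilon(\tau,\upsilon)=\varepsilon(\sigma\tau,\upsilon)\,\varepsilon(\sigma,\tau)^{{}^{\sigma\tau}p(\upsilon)}$. Two cocycles $(p_1,\varepsilon_1),(p_2,\varepsilon_2)$ are isomorphic if there is $(g,\theta)\in C^0(\Gamma,\mathbb{G})$ with $p_2(\sigma)=g^{-1}p_1(\sigma)\,{}^{\sigma}g\,\partial\theta(\sigma)^{-1}$ and $\varepsilon_2(\sigma,\tau)=\theta(\sigma\tau)\,\varepsilon_1(\sigma,\tau)^{{}^{\sigma\tau}g}\,{}^{\sigma}\theta(\tau)^{-1}\,(\theta(\sigma)^{-1})^{{}^{\sigma}p_2(\tau)}$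 for all $\sigma,\tau$. $H^1(\Gamma,\mathbb{G})$ is the set of isomorphism classes. Using the braiding, $Z^1(\Gamma,\mathbb{G})$ is a group under $(p_1,\varepsilon_1)(p_2,\varepsilon_2)=(p,\varepsilon)$, with $p(\sigma)=p_1(\sigma)p_2(\sigma)$ and $\varepsilon(\sigma,\tau)=\varepsilon_1(\sigma,\tau)^{p_2(\sigma\tau)}\,\varepsilon_2(\sigma,\tau)\,\{p_2(\sigma),{}^{\sigma}p_1(\tau)\}^{{}^{\sigma}p_2(\tau)}$. There is a right action of $Z^1(\Gamma,\mathbb{G})$ on $C^0(\Gamma,\mathbb{G})$, given by $(g,\theta)^{(p,\varepsilon)}=(g,\vartheta)$ with $\vartheta(\sigma)=\theta(\sigma)^{p(\sigma)}\,\{p(\sigma),{}^{\sigma}g\}\,\{g,p(\sigma)\}^{g^{-1}\,{}^{\sigma}g}$. *)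

theory Defs
  imports "HOL-Algebra.Bij" "HOL-Algebra.Coset"
begin

section \<open>Braided \<open>\<Gamma>\<close>-crossed-modules\<close>

text \<open>The argument order \<open>r x g\<close> stands for \<open>x\<^sup>g\<close>.\<close>

locale right_aut_action = G: group G + M: group M
  for G :: "('g, 'c) monoid_scheme" and M :: "('m, 'd) monoid_scheme"
    and r :: "'m \<Rightarrow> 'g \<Rightarrow> 'm" +
  assumes act_closed: "\<lbrakk>x \<in> carrier M; g \<in> carrier G\<rbrakk> \<Longrightarrow> r x g \<in> carrier M"
    and act_one: "x \<in> carrier M \<Longrightarrow> r x \<one>\<^bsub>G\<^esub> = x"
    and act_mult: "\<lbrakk>x \<in> carrier M; g \<in> carrier G; h \<in> carrier G\<rbrakk>
      \<Longrightarrow> r x (g \<otimes>\<^bsub>G\<^esub> h) = r (r x g) h"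
    and act_distrib: "\<lbrakk>x \<in> carrier M; y \<in> carrier M; g \<in> carrier G\<rbrakk>
      \<Longrightarrow> r (x \<otimes>\<^bsub>M\<^esub> y) g = r x g \<otimes>\<^bsub>M\<^esub> r y g"

record ('a, 'b) crossed_module =
  G0 :: "'a monoid"
  G1 :: "'b monoid"
  bd :: "'b \<Rightarrow> 'a"
  ract :: "'b \<Rightarrow> 'a \<Rightarrow> 'b"  (infixl \<open>\<triangleleft>\<index>\<close> 75)

record ('a, 'b, 's) gamma_crossed_module = "('a, 'b) crossed_module" +
  Gam :: "'s monoid"
  lact0 :: "'s \<Rightarrow> 'a \<Rightarrow> 'a"
  lact1 :: "'s \<Rightarrow> 'b \<Rightarrow> 'b"

record ('a, 'b, 's) braided_crossed_module = "('a, 'b, 's) gamma_crossed_module" +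
  braid :: "'a \<Rightarrow> 'a \<Rightarrow> 'b"

locale crossed_module =
  fixes X :: "('a, 'b, 'm) crossed_module_scheme" (structure)
  assumes bd_hom: "group_hom (G1 X) (G0 X) (bd X)"
    and right_action: "right_aut_action (G0 X) (G1 X) (ract X)"
    and bd_ract: "\<lbrakk>\<alpha> \<in> carrier (G1 X); g \<in> carrier (G0 X)\<rbrakk>
      \<Longrightarrow> bd X (\<alpha> \<triangleleft> g) = inv\<^bsub>G0 X\<^esub> g \<otimes>\<^bsub>G0 X\<^esub> bd X \<alpha> \<otimes>\<^bsub>G0 X\<^esub> g"
    and ract_bd: "\<lbrakk>\<alpha> \<in> carrier (G1 X); \<beta> \<in> carrier (G1 X)\<rbrakk>
      \<Longrightarrow> \<alpha> \<triangleleft> bd X \<beta> = inv\<^bsub>G1 X\<^esub> \<beta> \<otimes>\<^bsub>G1 X\<^esub> \<alpha> \<otimes>\<^bsub>G1 X\<^esub> \<beta>"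

locale gamma_crossed_module = crossed_module X
  for X :: "('a, 'b, 's, 'm) gamma_crossed_module_scheme" (structure) +
  assumes left_action0: "group_hom (Gam X) (AutoGroup (G0 X)) (lact0 X)"
    and left_action1: "group_hom (Gam X) (AutoGroup (G1 X)) (lact1 X)"
    and bd_equivariant: "\<lbrakk>\<sigma> \<in> carrier (Gam X); \<alpha> \<in> carrier (G1 X)\<rbrakk>
      \<Longrightarrow> bd X (lact1 X \<sigma> \<alpha>) = lact0 X \<sigma> (bd X \<alpha>)"
    and ract_equivariant:
      "\<lbrakk>\<sigma> \<in> carrier (Gam X); \<alpha> \<in> carrier (G1 X); g \<in> carrier (G0 X)\<rbrakk>
      \<Longrightarrow> lact1 X \<sigma> (\<alpha> \<triangleleft> g) = lact1 X \<sigma> \<alpha> \<triangleleft> lact0 X \<sigma> g"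

locale braided_crossed_module = gamma_crossed_module X
  for X :: "('a, 'b, 's, 'm) braided_crossed_module_scheme" (structure) +
  assumes braid_closed: "\<lbrakk>g \<in> carrier (G0 X); h \<in> carrier (G0 X)\<rbrakk>
      \<Longrightarrow> braid X g h \<in> carrier (G1 X)"
    and bd_braid: "\<lbrakk>g \<in> carrier (G0 X); h \<in> carrier (G0 X)\<rbrakk>
      \<Longrightarrow> bd X (braid X g h) =
        inv\<^bsub>G0 X\<^esub> g \<otimes>\<^bsub>G0 X\<^esub> inv\<^bsub>G0 X\<^esub> h \<otimes>\<^bsub>G0 X\<^esub> g \<otimes>\<^bsub>G0 X\<^esub> h"
    and braid_bd_left: "\<lbrakk>\<alpha> \<in> carrier (G1 X); g \<in> carrier (G0 X)\<rbrakk>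
      \<Longrightarrow> braid X (bd X \<alpha>) g = inv\<^bsub>G1 X\<^esub> \<alpha> \<otimes>\<^bsub>G1 X\<^esub> (\<alpha> \<triangleleft> g)"
    and braid_bd_right: "\<lbrakk>\<alpha> \<in> carrier (G1 X); g \<in> carrier (G0 X)\<rbrakk>
      \<Longrightarrow> braid X g (bd X \<alpha>) = (inv\<^bsub>G1 X\<^esub> \<alpha> \<triangleleft> g) \<otimes>\<^bsub>G1 X\<^esub> \<alpha>"
    and braid_mult_right:
      "\<lbrakk>g \<in> carrier (G0 X); h \<in> carrier (G0 X); k \<in> carrier (G0 X)\<rbrakk>
      \<Longrightarrow> braid X g (h \<otimes>\<^bsub>G0 X\<^esub> k) = braid X g k \<otimes>\<^bsub>G1 X\<^esub> (braid X g h \<triangleleft> k)"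
    and braid_mult_left:
      "\<lbrakk>g \<in> carrier (G0 X); h \<in> carrier (G0 X); k \<in> carrier (G0 X)\<rbrakk>
      \<Longrightarrow> braid X (g \<otimes>\<^bsub>G0 X\<^esub> h) k = (braid X g k \<triangleleft> h) \<otimes>\<^bsub>G1 X\<^esub> braid X h k"
    and braid_equivariant:
      "\<lbrakk>\<sigma> \<in> carrier (Gam X); g \<in> carrier (G0 X); h \<in> carrier (G0 X)\<rbrakk>
      \<Longrightarrow> braid X (lact0 X \<sigma> g) (lact0 X \<sigma> h) = lact1 X \<sigma> (braid X g h)"


section \<open>Cochains, \<open>Z\<^sup>0\<close>, \<open>B\<^sup>0\<close> and \<open>H\<^sup>0\<close>\<close>

text \<open>Maps out of \<open>\<Gamma>\<close> and \<open>\<Gamma> \<times> \<Gamma>\<close> are extensional functions on the carriers, so that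
  HOL equality is equality of maps between the underlying sets.\<close>

definition C0 :: "('a, 'b, 's, 'm) gamma_crossed_module_scheme \<Rightarrow> ('a \<times> ('s \<Rightarrow> 'b)) set" where
  "C0 X = {(g, \<theta>). g \<in> carrier (G0 X) \<and> \<theta> \<in> carrier (Gam X) \<rightarrow>\<^sub>E carrier (G1 X)
    \<and> \<theta> \<one>\<^bsub>Gam X\<^esub> = \<one>\<^bsub>G1 X\<^esub>}"

definition Z0 :: "('a, 'b, 's, 'm) gamma_crossed_module_scheme \<Rightarrow> ('a \<times> ('s \<Rightarrow> 'b)) monoid" where
  "Z0 X = \<lparr>
    carrier = {(g, \<theta>) \<in> C0 X.
      (\<forall>\<sigma>\<in>carrier (Gam X). bd X (\<theta> \<sigma>) = inv\<^bsub>G0 X\<^esub> g \<otimes>\<^bsub>G0 X\<^esub> lact0 X \<sigma> g) \<and>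
      (\<forall>\<sigma>\<in>carrier (Gam X). \<forall>\<tau>\<in>carrier (Gam X).
        \<theta> (\<sigma> \<otimes>\<^bsub>Gam X\<^esub> \<tau>) = \<theta> \<sigma> \<otimes>\<^bsub>G1 X\<^esub> lact1 X \<sigma> (\<theta> \<tau>))},
    mult = (\<lambda>(g1, \<theta>1) (g2, \<theta>2).
      (g1 \<otimes>\<^bsub>G0 X\<^esub> g2,
       \<lambda>\<sigma>\<in>carrier (Gam X). (\<theta>1 \<sigma> \<triangleleft>\<^bsub>X\<^esub> g2) \<otimes>\<^bsub>G1 X\<^esub> \<theta>2 \<sigma>)),
    one = (\<one>\<^bsub>G0 X\<^esub>, \<lambda>\<sigma>\<in>carrier (Gam X). \<one>\<^bsub>G1 X\<^esub>)\<rparr>"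

definition B0 :: "('a, 'b, 's, 'm) gamma_crossed_module_scheme \<Rightarrow> ('a \<times> ('s \<Rightarrow> 'b)) set" where
  "B0 X = {(bd X \<mu>, \<lambda>\<sigma>\<in>carrier (Gam X). inv\<^bsub>G1 X\<^esub> \<mu> \<otimes>\<^bsub>G1 X\<^esub> lact1 X \<sigma> \<mu>) | \<mu>.
    \<mu> \<in> carrier (G1 X)}"

definition H0 :: "('a, 'b, 's, 'm) gamma_crossed_module_scheme \<Rightarrow> ('a \<times> ('s \<Rightarrow> 'b)) set monoid" where
  "H0 X = Z0 X Mod B0 X"


section \<open>\<open>Z\<^sup>1\<close> and \<open>H\<^sup>1\<close>\<close>

definition Z1_set ::
  "('a, 'b, 's, 'm) gamma_crossed_module_scheme \<Rightarrow> (('s \<Rightarrow> 'a) \<times> ('s \<times> 's \<Rightarrow> 'b)) set" where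
  "Z1_set X = {(p, \<epsilon>).
    p \<in> carrier (Gam X) \<rightarrow>\<^sub>E carrier (G0 X) \<and> p \<one>\<^bsub>Gam X\<^esub> = \<one>\<^bsub>G0 X\<^esub> \<and>
    \<epsilon> \<in> carrier (Gam X) \<times> carrier (Gam X) \<rightarrow>\<^sub>E carrier (G1 X) \<and>
    \<epsilon> (\<one>\<^bsub>Gam X\<^esub>, \<one>\<^bsub>Gam X\<^esub>) = \<one>\<^bsub>G1 X\<^esub> \<and>
    (\<forall>\<sigma>\<in>carrier (Gam X). \<forall>\<tau>\<in>carrier (Gam X).
      p (\<sigma> \<otimes>\<^bsub>Gam X\<^esub> \<tau>) \<otimes>\<^bsub>G0 X\<^esub> bd X (\<epsilon> (\<sigma>, \<tau>)) = p \<sigma> \<otimes>\<^bsub>G0 X\<^esub> lact0 X \<sigma> (p \<tau>)) \<and>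
    (\<forall>\<sigma>\<in>carrier (Gam X). \<forall>\<tau>\<in>carrier (Gam X). \<forall>\<upsilon>\<in>carrier (Gam X).
      \<epsilon> (\<sigma>, \<tau> \<otimes>\<^bsub>Gam X\<^esub> \<upsilon>) \<otimes>\<^bsub>G1 X\<^esub> lact1 X \<sigma> (\<epsilon> (\<tau>, \<upsilon>)) =
      \<epsilon> (\<sigma> \<otimes>\<^bsub>Gam X\<^esub> \<tau>, \<upsilon>) \<otimes>\<^bsub>G1 X\<^esub>
        (\<epsilon> (\<sigma>, \<tau>) \<triangleleft>\<^bsub>X\<^esub> lact0 X (\<sigma> \<otimes>\<^bsub>Gam X\<^esub> \<tau>) (p \<upsilon>)))}"

definition Z1_iso :: "('a, 'b, 's, 'm) gamma_crossed_module_scheme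
    \<Rightarrow> (('s \<Rightarrow> 'a) \<times> ('s \<times> 's \<Rightarrow> 'b)) rel" where
  "Z1_iso X = {((p1, \<epsilon>1), (p2, \<epsilon>2)).
    (p1, \<epsilon>1) \<in> Z1_set X \<and> (p2, \<epsilon>2) \<in> Z1_set X \<and>
    (\<exists>(g, \<theta>) \<in> C0 X.
      (\<forall>\<sigma>\<in>carrier (Gam X).
        p2 \<sigma> = inv\<^bsub>G0 X\<^esub> g \<otimes>\<^bsub>G0 X\<^esub> p1 \<sigma> \<otimes>\<^bsub>G0 X\<^esub> lact0 X \<sigma> g
          \<otimes>\<^bsub>G0 X\<^esub> inv\<^bsub>G0 X\<^esub> (bd X (\<theta> \<sigma>))) \<and>
      (\<forall>\<sigma>\<in>carrier (Gam X). \<forall>\<tau>\<in>carrier (Gam X).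
        \<epsilon>2 (\<sigma>, \<tau>) = \<theta> (\<sigma> \<otimes>\<^bsub>Gam X\<^esub> \<tau>)
          \<otimes>\<^bsub>G1 X\<^esub> (\<epsilon>1 (\<sigma>, \<tau>) \<triangleleft>\<^bsub>X\<^esub> lact0 X (\<sigma> \<otimes>\<^bsub>Gam X\<^esub> \<tau>) g)
          \<otimes>\<^bsub>G1 X\<^esub> inv\<^bsub>G1 X\<^esub> (lact1 X \<sigma> (\<theta> \<tau>))
          \<otimes>\<^bsub>G1 X\<^esub> (inv\<^bsub>G1 X\<^esub> (\<theta> \<sigma>) \<triangleleft>\<^bsub>X\<^esub> lact0 X \<sigma> (p2 \<tau>))))}"

definition Z1_class :: "('a, 'b, 's, 'm) gamma_crossed_module_scheme
    \<Rightarrow> (('s \<Rightarrow> 'a) \<times> ('s \<times> 's \<Rightarrow> 'b)) \<Rightarrow> (('s \<Rightarrow> 'a) \<times> ('s \<times> 's \<Rightarrow> 'b)) set" where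
  "Z1_class X z = Z1_iso X `` {z}"

definition H1_set :: "('a, 'b, 's, 'm) gamma_crossed_module_scheme
    \<Rightarrow> (('s \<Rightarrow> 'a) \<times> ('s \<times> 's \<Rightarrow> 'b)) set set" where
  "H1_set X = Z1_set X // Z1_iso X"

definition Z1 :: "('a, 'b, 's, 'm) braided_crossed_module_scheme
    \<Rightarrow> (('s \<Rightarrow> 'a) \<times> ('s \<times> 's \<Rightarrow> 'b)) monoid" where
  "Z1 X = \<lparr>
    carrier = Z1_set X,
    mult = (\<lambda>(p1, \<epsilon>1) (p2, \<epsilon>2).
      (\<lambda>\<sigma>\<in>carrier (Gam X). p1 \<sigma> \<otimes>\<^bsub>G0 X\<^esub> p2 \<sigma>,
       \<lambda>(\<sigma>, \<tau>)\<in>carrier (Gam X) \<times> carrier (Gam X).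
         (\<epsilon>1 (\<sigma>, \<tau>) \<triangleleft>\<^bsub>X\<^esub> p2 (\<sigma> \<otimes>\<^bsub>Gam X\<^esub> \<tau>)) \<otimes>\<^bsub>G1 X\<^esub> \<epsilon>2 (\<sigma>, \<tau>)
           \<otimes>\<^bsub>G1 X\<^esub> (braid X (p2 \<sigma>) (lact0 X \<sigma> (p1 \<tau>)) \<triangleleft>\<^bsub>X\<^esub> lact0 X \<sigma> (p2 \<tau>)))),
    one = (\<lambda>\<sigma>\<in>carrier (Gam X). \<one>\<^bsub>G0 X\<^esub>,
           \<lambda>_\<in>carrier (Gam X) \<times> carrier (Gam X). \<one>\<^bsub>G1 X\<^esub>)\<rparr>"

text \<open>The union over all representatives is the class of any single product of representatives
  exactly when the product of \<open>Z\<^sup>1\<close> is compatible with isomorphism of cocycles. Similarly for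
  \<open>H0_act\<close> below.\<close>

definition H1 :: "('a, 'b, 's, 'm) braided_crossed_module_scheme
    \<Rightarrow> (('s \<Rightarrow> 'a) \<times> ('s \<times> 's \<Rightarrow> 'b)) set monoid" where
  "H1 X = \<lparr>
    carrier = H1_set X,
    mult = (\<lambda>U V. \<Union>z\<in>U. \<Union>w\<in>V. Z1_class X (z \<otimes>\<^bsub>Z1 X\<^esub> w)),
    one = Z1_class X \<one>\<^bsub>Z1 X\<^esub>\<rparr>"


section \<open>The action of \<open>Z\<^sup>1\<close> on \<open>C\<^sup>0\<close> and the induced operation on cosets\<close>

definition C0_act :: "('a, 'b, 's, 'm) braided_crossed_module_scheme
    \<Rightarrow> 'a \<times> ('s \<Rightarrow> 'b) \<Rightarrow> ('s \<Rightarrow> 'a) \<times> ('s \<times> 's \<Rightarrow> 'b) \<Rightarrow> 'a \<times> ('s \<Rightarrow> 'b)" where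
  "C0_act X = (\<lambda>(g, \<theta>) (p, \<epsilon>).
    (g, \<lambda>\<sigma>\<in>carrier (Gam X).
      (\<theta> \<sigma> \<triangleleft>\<^bsub>X\<^esub> p \<sigma>) \<otimes>\<^bsub>G1 X\<^esub> braid X (p \<sigma>) (lact0 X \<sigma> g)
        \<otimes>\<^bsub>G1 X\<^esub> (braid X g (p \<sigma>) \<triangleleft>\<^bsub>X\<^esub> (inv\<^bsub>G0 X\<^esub> g \<otimes>\<^bsub>G0 X\<^esub> lact0 X \<sigma> g))))"

definition H0_act :: "('a, 'b, 's, 'm) braided_crossed_module_scheme
    \<Rightarrow> ('a \<times> ('s \<Rightarrow> 'b)) set \<Rightarrow> (('s \<Rightarrow> 'a) \<times> ('s \<times> 's \<Rightarrow> 'b)) set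
    \<Rightarrow> ('a \<times> ('s \<Rightarrow> 'b)) set" where
  "H0_act X A U = (\<Union>c\<in>A. \<Union>z\<in>U. B0 X #>\<^bsub>Z0 X\<^esub> C0_act X c z)"

end

theory Submission
  imports Defs
begin

text \<open>A crossed module is a group of objects \<open>G\<^sub>0\<close> together with arrows
  \<open>\<alpha> : x \<rightarrow> x \<cdot> \<partial> \<alpha>\<close>, one for each object \<open>x\<close> and each \<open>\<alpha> \<in> G\<^sub>1\<close>. Composition of arrows is
  the product of \<open>G\<^sub>1\<close>, multiplying an arrow by an object on the left does not change \<open>\<alpha>\<close>, and
  multiplying it by \<open>g\<close> on the right replaces \<open>\<alpha>\<close> by \<open>\<alpha>\<^sup>g\<close>. The element \<open>{g, h}\<close> is the
  braiding \<open>h \<cdot> g \<rightarrow> g \<cdot> h\<close>. An identity in \<open>G\<^sub>1\<close> is then a commuting diagram, and it is proved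
  by three moves: the interchange law (\<open>slide\<close>), naturality of the braiding
  (\<open>braid_natural_left\<close>, \<open>braid_natural_right\<close>), and the hexagon axioms, which split a braiding
  with a product. In a cocycle \<open>(p, \<epsilon>)\<close> the value \<open>\<epsilon>(\<sigma>, \<tau>)\<close> is an arrow
  \<open>p(\<sigma>\<tau>) \<rightarrow> p(\<sigma>) \<cdot> \<^sup>\<sigma>p(\<tau>)\<close>, and in an isomorphism \<open>(g, \<theta>)\<close> from \<open>(p\<^sub>1, \<epsilon>\<^sub>1)\<close> to
  \<open>(p\<^sub>2, \<epsilon>\<^sub>2)\<close> the value \<open>\<theta>(\<sigma>)\<close> is an arrow \<open>p\<^sub>2(\<sigma>) \<rightarrow> g\<inverse> \<cdot> p\<^sub>1(\<sigma>) \<cdot> \<^sup>\<sigma>g\<close>.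

  \<^emph>\<open>The group \<open>H\<^sup>1\<close>.\<close> Both sides of the cocycle identity of a product factor through the
  corresponding sides for the two factors, with the same remaining factor built from braidings
  (\<open>product_cocycle_left\<close>, \<open>product_cocycle_right\<close>). So products of cocycles are cocycles, and
  conversely, if the product and the second factor are cocycles, then so is the first; this
  provides inverses. Associativity is \<open>product_assoc\<close>. Multiplying an isomorphism of cocycles by a
  fixed cocycle requires moving \<open>\<^sup>\<sigma>g\<close>, or \<open>g\<inverse>\<close>, past that cocycle; the braiding does this, and
  the result is again an isomorphism (\<open>iso_product_right\<close>, \<open>iso_product_left\<close>). Hence the product
  descends to isomorphism classes.

  \<^emph>\<open>The group \<open>H\<^sup>0\<close>.\<close> Naturality of the braiding says that two elements of \<open>Z\<^sup>0\<close> with first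
  components \<open>g\<close> and \<open>h\<close> commute up to the coboundary of \<open>{g, h}\<close>.

  \<^emph>\<open>The action.\<close> The double braiding \<open>m(g, h) = {g, h}{h, g}\<close> takes values in the kernel of
  \<open>\<partial>\<close>, which is central with trivial action of \<open>G\<^sub>0\<close>; it is bimultiplicative and vanishes when
  an argument is a boundary. On \<open>Z\<^sup>0\<close> the action of \<open>(p, \<epsilon>)\<close> is multiplication of \<open>\<theta>(\<sigma>)\<close> by
  \<open>m(p(\<sigma>), g)\<close> (\<open>C0_act_eq\<close>), so its algebraic properties follow from those of \<open>m\<close>. An isomorphism
  \<open>(g, \<theta>)\<close> of cocycles changes the result of acting on an element with first component \<open>h\<close> by
  the coboundary of \<open>m(g, h)\<close> (\<open>C0_act_iso\<close>), which is why the action descends to \<open>H\<^sup>1\<close> and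
  \<open>H\<^sup>0\<close>.\<close>

section \<open>Calculus of crossed modules\<close>

lemma (in group) inv_mult_cancel_left [simp]:
  assumes "x \<in> carrier G" "y \<in> carrier G"
  shows "inv x \<otimes> (x \<otimes> y) = y" and "x \<otimes> (inv x \<otimes> y) = y"
  using assms by (simp_all flip: m_assoc)

context crossed_module
begin

sublocale K0: group "G0 X"
  using bd_hom by (simp add: group_hom_def)

sublocale K1: group "G1 X"
  using bd_hom by (simp add: group_hom_def)

sublocale bd: group_hom "G1 X" "G0 X" "bd X"
  by (rule bd_hom)

sublocale act: right_aut_action "G0 X" "G1 X" "ract X"
  by (rule right_action)

text \<open>\<open>Ob\<close> and \<open>Ar\<close> abbreviate objects and arrows; in a product, \<open>\<cdot>\<close> binds tighter than
  the action and the action tighter than \<open>\<bullet>\<close>, so that \<open>\<alpha> \<triangleleft> g \<cdot> h \<bullet> \<beta>\<close> is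
  \<open>\<alpha>\<^sup>g\<^sup>h \<beta>\<close>.\<close>

abbreviation Ob where "Ob \<equiv> carrier (G0 X)"
abbreviation Ar where "Ar \<equiv> carrier (G1 X)"
abbreviation mult0 (infixl \<open>\<cdot>\<close> 80) where "g \<cdot> h \<equiv> g \<otimes>\<^bsub>G0 X\<^esub> h"
abbreviation mult1 (infixl \<open>\<bullet>\<close> 70) where "\<alpha> \<bullet> \<beta> \<equiv> \<alpha> \<otimes>\<^bsub>G1 X\<^esub> \<beta>"
abbreviation inv0 where "inv0 g \<equiv> inv\<^bsub>G0 X\<^esub> g"
abbreviation inv1 where "inv1 \<alpha> \<equiv> inv\<^bsub>G1 X\<^esub> \<alpha>"
abbreviation one0 (\<open>\<one>\<^sub>0\<close>) where "\<one>\<^sub>0 \<equiv> \<one>\<^bsub>G0 X\<^esub>"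
abbreviation one1 (\<open>\<one>\<^sub>1\<close>) where "\<one>\<^sub>1 \<equiv> \<one>\<^bsub>G1 X\<^esub>"
abbreviation boundary (\<open>\<partial>\<close>) where "\<partial> \<equiv> bd X"

declare act.act_closed [simp] act.act_one [simp]

lemma one_ract [simp]: "g \<in> Ob \<Longrightarrow> \<one>\<^sub>1 \<triangleleft> g = \<one>\<^sub>1"
  using act.act_distrib[of "\<one>\<^sub>1" "\<one>\<^sub>1" g] by simp

lemma inv_ract: "\<lbrakk>\<alpha> \<in> Ar; g \<in> Ob\<rbrakk> \<Longrightarrow> inv1 \<alpha> \<triangleleft> g = inv1 (\<alpha> \<triangleleft> g)"
  using act.act_distrib[of "inv1 \<alpha>" \<alpha> g] by (simp add: K1.inv_equality)

text \<open>These equations bring every element to a product of elements \<open>\<alpha> \<triangleleft> g\<close> and their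
  inverses, with \<open>g\<close> a word, all bracketed to the right. They use the two group structures and the action only; the
  moves that involve \<open>\<partial>\<close> or the braiding are always applied explicitly.\<close>

lemmas word_simps = K0.m_assoc K1.m_assoc act.act_distrib act.act_mult [symmetric] inv_ract
  K0.inv_mult_group K1.inv_mult_group

text \<open>The Peiffer identity, read as the interchange law for an arrow \<open>\<beta> : g \<rightarrow> h\<close>.\<close>

lemma slide:
  assumes "\<alpha> \<in> Ar" "\<beta> \<in> Ar" "g \<in> Ob" "g \<cdot> \<partial> \<beta> = h"
  shows "(\<alpha> \<triangleleft> g) \<bullet> \<beta> = \<beta> \<bullet> (\<alpha> \<triangleleft> h)"
proof -
  have "\<beta> \<bullet> (\<alpha> \<triangleleft> h) = \<beta> \<bullet> ((\<alpha> \<triangleleft> g) \<triangleleft> \<partial> \<beta>)"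
    using assms by (auto simp: word_simps)
  also have "\<dots> = (\<alpha> \<triangleleft> g) \<bullet> \<beta>"
    using assms by (simp add: ract_bd word_simps del: act.act_mult [symmetric])
  finally show ?thesis ..
qed

text \<open>An arrow from an object to itself slides past every other arrow unchanged.\<close>

lemma kernel_central:
  assumes "\<alpha> \<in> Ar" "\<beta> \<in> Ar" "\<partial> \<alpha> = \<one>\<^sub>0"
  shows "\<beta> \<bullet> \<alpha> = \<alpha> \<bullet> \<beta>"
  using slide[of \<beta> \<alpha> "\<one>\<^sub>0"] assms by simp

lemma ract_inject:
  assumes "\<alpha> \<in> Ar" "\<beta> \<in> Ar" "g \<in> Ob" "\<alpha> \<triangleleft> g = \<beta> \<triangleleft> g"
  shows "\<alpha> = \<beta>"
proof -
  have "(\<alpha> \<triangleleft> g) \<triangleleft> inv0 g = \<alpha>" "(\<beta> \<triangleleft> g) \<triangleleft> inv0 g = \<beta>"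
    using assms(1-3) by (simp_all add: word_simps)
  then show ?thesis
    using assms(4) by metis
qed

text \<open>Strips the second factor and the braidings from the two sides of the cocycle
  identity of a product, in the form given to them by \<open>product_cocycle_left\<close> and
  \<open>product_cocycle_right\<close>.\<close>

lemma ract_mult_cancel:
  assumes "\<alpha> \<in> Ar" "\<beta> \<in> Ar" "\<gamma> \<in> Ar" "g \<in> Ob" "\<kappa> \<in> Ar"
  shows "(\<alpha> \<triangleleft> g) \<bullet> \<gamma> \<bullet> \<kappa> = (\<beta> \<triangleleft> g) \<bullet> \<gamma> \<bullet> \<kappa> \<longleftrightarrow> \<alpha> = \<beta>"
  using assms ract_inject[of \<alpha> \<beta> g] by auto

end

context gamma_crossed_module
begin

abbreviation \<Gamma> where "\<Gamma> \<equiv> carrier (Gam X)"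
abbreviation multG (infixl \<open>\<star>\<close> 80) where "\<sigma> \<star> \<tau> \<equiv> \<sigma> \<otimes>\<^bsub>Gam X\<^esub> \<tau>"
abbreviation oneG (\<open>\<one>\<^sub>\<Gamma>\<close>) where "\<one>\<^sub>\<Gamma> \<equiv> \<one>\<^bsub>Gam X\<^esub>"
abbreviation act0 (infixr \<open>\<rightharpoonup>\<close> 90) where "\<sigma> \<rightharpoonup> g \<equiv> lact0 X \<sigma> g"
abbreviation act1 (infixr \<open>\<rightharpoondown>\<close> 90) where "\<sigma> \<rightharpoondown> \<alpha> \<equiv> lact1 X \<sigma> \<alpha>"

sublocale Gam: group "Gam X"
  using left_action0 by (simp add: group_hom_def)

lemma lact0_group_hom: "\<sigma> \<in> \<Gamma> \<Longrightarrow> group_hom (G0 X) (G0 X) (lact0 X \<sigma>)"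
  using group_hom.hom_closed [OF left_action0, of \<sigma>] K0.is_group
  by (auto simp: AutoGroup_def auto_def intro!: group_hom.intro group_hom_axioms.intro)

lemma lact1_group_hom: "\<sigma> \<in> \<Gamma> \<Longrightarrow> group_hom (G1 X) (G1 X) (lact1 X \<sigma>)"
  using group_hom.hom_closed [OF left_action1, of \<sigma>] K1.is_group
  by (auto simp: AutoGroup_def auto_def intro!: group_hom.intro group_hom_axioms.intro)

lemmas lact0_simps [simp] =
  group_hom.hom_closed [OF lact0_group_hom] group_hom.hom_mult [OF lact0_group_hom]
  group_hom.hom_one [OF lact0_group_hom] group_hom.hom_inv [OF lact0_group_hom]

lemmas lact1_simps [simp] =
  group_hom.hom_closed [OF lact1_group_hom] group_hom.hom_mult [OF lact1_group_hom]
  group_hom.hom_one [OF lact1_group_hom] group_hom.hom_inv [OF lact1_group_hom]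

lemma lact0_one [simp]: "g \<in> Ob \<Longrightarrow> \<one>\<^sub>\<Gamma> \<rightharpoonup> g = g"
  using group_hom.hom_one [OF left_action0] by (simp add: AutoGroup_def BijGroup_def)

lemma lact1_one [simp]: "\<alpha> \<in> Ar \<Longrightarrow> \<one>\<^sub>\<Gamma> \<rightharpoondown> \<alpha> = \<alpha>"
  using group_hom.hom_one [OF left_action1] by (simp add: AutoGroup_def BijGroup_def)

lemma lact0_mult [simp]:
  "\<lbrakk>\<sigma> \<in> \<Gamma>; \<tau> \<in> \<Gamma>; g \<in> Ob\<rbrakk> \<Longrightarrow> (\<sigma> \<star> \<tau>) \<rightharpoonup> g = \<sigma> \<rightharpoonup> \<tau> \<rightharpoonup> g"
  using group_hom.hom_mult [OF left_action0, of \<sigma> \<tau>] group_hom.hom_closed [OF left_action0, of \<sigma>] group_hom.hom_closed [OF left_action0, of \<tau>]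
  by (simp add: AutoGroup_def BijGroup_def auto_def compose_def)

lemma lact1_mult [simp]:
  "\<lbrakk>\<sigma> \<in> \<Gamma>; \<tau> \<in> \<Gamma>; \<alpha> \<in> Ar\<rbrakk> \<Longrightarrow> (\<sigma> \<star> \<tau>) \<rightharpoondown> \<alpha> = \<sigma> \<rightharpoondown> \<tau> \<rightharpoondown> \<alpha>"
  using group_hom.hom_mult [OF left_action1, of \<sigma> \<tau>] group_hom.hom_closed [OF left_action1, of \<sigma>] group_hom.hom_closed [OF left_action1, of \<tau>]
  by (simp add: AutoGroup_def BijGroup_def auto_def compose_def)

declare ract_equivariant [simp]
declare bd_equivariant [simp]

end

context braided_crossed_module
begin

abbreviation braiding (\<open>\<lbrace>_, _\<rbrace>\<close>) where "\<lbrace>g, h\<rbrace> \<equiv> braid X g h"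

declare braid_closed [simp] braid_equivariant [symmetric, simp]

lemma braid_one_left [simp]: "g \<in> Ob \<Longrightarrow> \<lbrace>\<one>\<^sub>0, g\<rbrace> = \<one>\<^sub>1"
  using braid_bd_left[of "\<one>\<^sub>1" g] by simp

lemma braid_one_right [simp]: "g \<in> Ob \<Longrightarrow> \<lbrace>g, \<one>\<^sub>0\<rbrace> = \<one>\<^sub>1"
  using braid_bd_right[of "\<one>\<^sub>1" g] by simp

lemma mult_bd_braid:
  "\<lbrakk>g \<in> Ob; h \<in> Ob\<rbrakk> \<Longrightarrow> h \<cdot> (g \<cdot> \<partial> \<lbrace>g, h\<rbrace>) = g \<cdot> h"
  by (simp add: bd_braid word_simps)

lemma braid_slide:
  assumes "\<alpha> \<in> Ar" "g \<in> Ob" "h \<in> Ob"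
  shows "(\<alpha> \<triangleleft> (h \<cdot> g)) \<bullet> \<lbrace>g, h\<rbrace> = \<lbrace>g, h\<rbrace> \<bullet> (\<alpha> \<triangleleft> (g \<cdot> h))"
  using assms by (intro slide) (simp_all add: word_simps mult_bd_braid)

text \<open>The braiding is natural in each variable: the hexagon axiom splits off the braiding
  with \<open>\<partial> \<alpha>\<close>, and the axiom for braidings with a boundary evaluates it.\<close>

lemma braid_natural_left:
  assumes "\<alpha> \<in> Ar" "g \<in> Ob" "h \<in> Ob"
  shows "\<lbrace>g, h\<rbrace> \<bullet> (\<alpha> \<triangleleft> h) = \<alpha> \<bullet> \<lbrace>g \<cdot> \<partial> \<alpha>, h\<rbrace>"
  using assms by (simp add: braid_mult_left braid_bd_left ract_bd word_simps)

lemma braid_natural_right: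
  assumes "\<alpha> \<in> Ar" "g \<in> Ob" "h \<in> Ob"
  shows "\<lbrace>g, h\<rbrace> \<bullet> \<alpha> = (\<alpha> \<triangleleft> g) \<bullet> \<lbrace>g, h \<cdot> \<partial> \<alpha>\<rbrace>"
  using assms by (simp add: braid_mult_right braid_bd_right ract_bd word_simps)

end

section \<open>Cocycle identities for braided crossed modules\<close>

context braided_crossed_module
begin

text \<open>Here the braiding with \<open>\<partial> \<alpha> = \<one>\<close> is trivial on the one hand, and measures the
  action of \<open>g\<close> on \<open>\<alpha>\<close> on the other. In a crossed module without a braiding, \<open>G\<^sub>0\<close> can act
  non-trivially on the kernel of \<open>\<partial>\<close>.\<close>

lemma kernel_ract_trivial:
  assumes "\<alpha> \<in> Ar" "g \<in> Ob" "\<partial> \<alpha> = \<one>\<^sub>0"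
  shows "\<alpha> \<triangleleft> g = \<alpha>"
proof -
  have "inv1 \<alpha> \<bullet> (\<alpha> \<triangleleft> g) = \<one>\<^sub>1"
    using braid_bd_left[of \<alpha> g] assms by simp
  then show ?thesis
    using assms by (metis K1.inv_closed K1.inv_comm K1.inv_equality K1.inv_inv act.act_closed)
qed

text \<open>The double braiding \<open>h \<cdot> g \<rightarrow> g \<cdot> h \<rightarrow> h \<cdot> g\<close>, which measures the failure of the
  braiding to be symmetric.\<close>

definition monodromy where "monodromy g h = \<lbrace>g, h\<rbrace> \<bullet> \<lbrace>h, g\<rbrace>"

lemma monodromy_closed [simp]: "\<lbrakk>g \<in> Ob; h \<in> Ob\<rbrakk> \<Longrightarrow> monodromy g h \<in> Ar"
  by (simp add: monodromy_def)

lemma bd_monodromy [simp]: "\<lbrakk>g \<in> Ob; h \<in> Ob\<rbrakk> \<Longrightarrow> \<partial> (monodromy g h) = \<one>\<^sub>0"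
  by (simp add: monodromy_def bd_braid word_simps)

lemma monodromy_ract [simp]:
  "\<lbrakk>g \<in> Ob; h \<in> Ob; k \<in> Ob\<rbrakk> \<Longrightarrow> monodromy g h \<triangleleft> k = monodromy g h"
  by (simp add: kernel_ract_trivial)

lemma monodromy_central:
  "\<lbrakk>g \<in> Ob; h \<in> Ob; \<alpha> \<in> Ar\<rbrakk> \<Longrightarrow> \<alpha> \<bullet> monodromy g h = monodromy g h \<bullet> \<alpha>"
  by (rule kernel_central) simp_all

text \<open>The two double braidings are conjugate by \<open>{g, h}\<close>, and they are central.\<close>

lemma monodromy_sym:
  assumes "g \<in> Ob" "h \<in> Ob"
  shows "monodromy h g = monodromy g h"
proof -
  have "\<lbrace>g, h\<rbrace> \<bullet> monodromy h g = monodromy g h \<bullet> \<lbrace>g, h\<rbrace>"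
    using assms by (simp add: monodromy_def K1.m_assoc)
  also have "\<dots> = \<lbrace>g, h\<rbrace> \<bullet> monodromy g h"
    using assms by (simp add: monodromy_central)
  finally show ?thesis
    using assms by simp
qed

text \<open>The hexagon axioms enclose \<open>monodromy h k\<close> between the two halves of
  \<open>monodromy g k\<close>; being central, it can be moved out.\<close>

lemma monodromy_mult_left:
  assumes "g \<in> Ob" "h \<in> Ob" "k \<in> Ob"
  shows "monodromy (g \<cdot> h) k = monodromy g k \<bullet> monodromy h k"
proof -
  have "monodromy (g \<cdot> h) k = (\<lbrace>g, k\<rbrace> \<triangleleft> h) \<bullet> (monodromy h k \<bullet> (\<lbrace>k, g\<rbrace> \<triangleleft> h))"
    using assms by (simp add: monodromy_def braid_mult_left braid_mult_right word_simps)
  also have "\<dots> = (monodromy g k \<triangleleft> h) \<bullet> monodromy h k"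
    using assms monodromy_central[of h k "\<lbrace>k, g\<rbrace> \<triangleleft> h"]
    by (simp add: word_simps monodromy_def[of g k] del: monodromy_ract)
  finally show ?thesis using assms by simp
qed

lemma monodromy_mult_right:
  "\<lbrakk>g \<in> Ob; h \<in> Ob; k \<in> Ob\<rbrakk>
    \<Longrightarrow> monodromy g (h \<cdot> k) = monodromy g h \<bullet> monodromy g k"
  using monodromy_mult_left[of h k g] by (simp add: monodromy_sym[of g])

lemma monodromy_bd_left [simp]: "\<lbrakk>\<alpha> \<in> Ar; g \<in> Ob\<rbrakk> \<Longrightarrow> monodromy (\<partial> \<alpha>) g = \<one>\<^sub>1"
  by (simp add: monodromy_def braid_bd_left braid_bd_right word_simps)

lemma monodromy_bd_right [simp]: "\<lbrakk>\<alpha> \<in> Ar; g \<in> Ob\<rbrakk> \<Longrightarrow> monodromy g (\<partial> \<alpha>) = \<one>\<^sub>1"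
  using monodromy_sym[of "\<partial> \<alpha>" g] by simp

lemma monodromy_inv_left:
  "\<lbrakk>g \<in> Ob; h \<in> Ob\<rbrakk> \<Longrightarrow> monodromy (inv0 g) h = inv1 (monodromy g h)"
  using monodromy_mult_left[of "inv0 g" g h]
  by (simp add: monodromy_def K1.inv_equality)

lemma monodromy_equivariant:
  "\<lbrakk>\<sigma> \<in> \<Gamma>; g \<in> Ob; h \<in> Ob\<rbrakk>
    \<Longrightarrow> \<sigma> \<rightharpoondown> monodromy g h = monodromy (\<sigma> \<rightharpoonup> g) (\<sigma> \<rightharpoonup> h)"
  by (simp add: monodromy_def)

text \<open>This simplifies the formula for the action of \<open>Z\<^sup>1\<close> on cochains when the cochain lies
  in \<open>Z\<^sup>0\<close>: then \<open>\<theta>\<close> is an arrow from \<open>g\<close> to \<open>g' = \<^sup>\<sigma>g\<close>, and naturality along \<open>\<theta>\<close> replaces \<open>g'\<close>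
  by \<open>g\<close> in the braiding.\<close>

lemma act_eq_monodromy:
  assumes C: "g \<in> Ob" "g' \<in> Ob" "p \<in> Ob" "\<theta> \<in> Ar" and \<theta>: "\<partial> \<theta> = inv0 g \<cdot> g'"
  shows "(\<theta> \<triangleleft> p) \<bullet> \<lbrace>p, g'\<rbrace> \<bullet> (\<lbrace>g, p\<rbrace> \<triangleleft> (inv0 g \<cdot> g')) = monodromy p g \<bullet> \<theta>"
proof -
  have "g' = g \<cdot> \<partial> \<theta>"
    using C \<theta> by simp
  then have "(\<theta> \<triangleleft> p) \<bullet> \<lbrace>p, g'\<rbrace> = \<lbrace>p, g\<rbrace> \<bullet> \<theta>"
    using C by (simp add: braid_natural_right)
  moreover have "\<lbrace>g, p\<rbrace> \<triangleleft> (inv0 g \<cdot> g') = inv1 \<theta> \<bullet> \<lbrace>g, p\<rbrace> \<bullet> \<theta>"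
    using C \<theta> by (simp flip: \<theta> add: ract_bd)
  ultimately show ?thesis
    using C by (simp add: monodromy_def word_simps)
qed

lemma braid_natural:
  assumes "\<alpha> \<in> Ar" "\<beta> \<in> Ar" "g \<in> Ob" "h \<in> Ob"
  shows "\<lbrace>g, h\<rbrace> \<bullet> (\<alpha> \<triangleleft> h) \<bullet> \<beta> = (\<beta> \<triangleleft> g) \<bullet> \<alpha> \<bullet> \<lbrace>g \<cdot> \<partial> \<alpha>, h \<cdot> \<partial> \<beta>\<rbrace>"
proof -
  have "\<lbrace>g, h\<rbrace> \<bullet> (\<alpha> \<triangleleft> h) \<bullet> \<beta> = \<alpha> \<bullet> (\<lbrace>g \<cdot> \<partial> \<alpha>, h\<rbrace> \<bullet> \<beta>)"
    using assms by (simp add: braid_natural_left word_simps)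
  also have "\<dots> = (\<alpha> \<bullet> (\<beta> \<triangleleft> (g \<cdot> \<partial> \<alpha>))) \<bullet> \<lbrace>g \<cdot> \<partial> \<alpha>, h \<cdot> \<partial> \<beta>\<rbrace>"
    using assms by (simp add: braid_natural_right word_simps)
  also have "\<alpha> \<bullet> (\<beta> \<triangleleft> (g \<cdot> \<partial> \<alpha>)) = (\<beta> \<triangleleft> g) \<bullet> \<alpha>"
    using assms by (simp add: slide)
  finally show ?thesis .
qed

text \<open>Two ways to reorder \<open>x \<cdot> y \<cdot> g \<cdot> h\<close> into \<open>g \<cdot> x \<cdot> h \<cdot> y\<close>: moving \<open>g\<close> past \<open>x \<cdot> y\<close>
  first, or moving \<open>y\<close> past \<open>g \<cdot> h\<close> first. By the hexagon axioms both consist of the same three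
  elementary braidings, up to sliding one past another.\<close>

lemma braid_mult_exchange:
  assumes "g \<in> Ob" "h \<in> Ob" "x \<in> Ob" "y \<in> Ob"
  shows "(\<lbrace>g, x \<cdot> y\<rbrace> \<triangleleft> h) \<bullet> \<lbrace>h, y\<rbrace> = \<lbrace>g \<cdot> h, y\<rbrace> \<bullet> (\<lbrace>g, x\<rbrace> \<triangleleft> (h \<cdot> y))"
  using assms by (simp add: braid_mult_left braid_mult_right word_simps braid_slide)

text \<open>The left-hand side of the cocycle identity for a product of cocycles. Letters with a
  prime belong to the second factor; \<open>x, y, z\<close> stand for \<open>p(\<sigma>)\<close>, \<open>\<^sup>\<sigma>p(\<tau>)\<close>, \<open>\<^sup>\<sigma>\<^sup>\<tau>p(\<upsilon>)\<close>, and
  \<open>u, v, w\<close> for \<open>p(\<sigma>\<tau>)\<close>, \<open>\<^sup>\<sigma>p(\<tau>\<upsilon>)\<close>, \<open>p(\<sigma>\<tau>\<upsilon>)\<close>. The arrows are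
  \<open>d : w \<rightarrow> x \<cdot> v\<close> and \<open>c : v \<rightarrow> y \<cdot> z\<close>, coming from the two values of \<open>\<epsilon>\<close> on this side. The proof moves \<open>c\<close>
  to the left through the braiding and through \<open>d'\<close>, and \<open>c'\<close> to the left through the remaining
  braiding, so that the two factors separate.\<close>

lemma product_cocycle_left:
  assumes C: "x' \<in> Ob" "v \<in> Ob" "v' \<in> Ob" "w' \<in> Ob" "y \<in> Ob" "z \<in> Ob" "y' \<in> Ob" "z' \<in> Ob"
      "c \<in> Ar" "c' \<in> Ar" "d \<in> Ar" "d' \<in> Ar"
    and d': "w' \<cdot> \<partial> d' = x' \<cdot> v'" and c: "v \<cdot> \<partial> c = y \<cdot> z" and c': "v' \<cdot> \<partial> c' = y' \<cdot> z'"
  shows "(d \<triangleleft> w') \<bullet> d' \<bullet> (\<lbrace>x', v\<rbrace> \<triangleleft> v') \<bullet> ((c \<triangleleft> v') \<bullet> c' \<bullet> (\<lbrace>y', z\<rbrace> \<triangleleft> z'))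
    = ((d \<bullet> c) \<triangleleft> w') \<bullet> (d' \<bullet> c') \<bullet> (((\<lbrace>x', y \<cdot> z\<rbrace> \<triangleleft> y') \<bullet> \<lbrace>y', z\<rbrace>) \<triangleleft> z')"
proof -
  have "(d \<triangleleft> w') \<bullet> d' \<bullet> (\<lbrace>x', v\<rbrace> \<triangleleft> v') \<bullet> ((c \<triangleleft> v') \<bullet> c' \<bullet> (\<lbrace>y', z\<rbrace> \<triangleleft> z'))
    = (d \<triangleleft> w') \<bullet> d' \<bullet> ((\<lbrace>x', v\<rbrace> \<bullet> c) \<triangleleft> v') \<bullet> (c' \<bullet> (\<lbrace>y', z\<rbrace> \<triangleleft> z'))"
    using C by (simp add: word_simps)
  also have "\<lbrace>x', v\<rbrace> \<bullet> c = (c \<triangleleft> x') \<bullet> \<lbrace>x', y \<cdot> z\<rbrace>"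
    using C c by (simp add: braid_natural_right)
  also have "(d \<triangleleft> w') \<bullet> d' \<bullet> (((c \<triangleleft> x') \<bullet> \<lbrace>x', y \<cdot> z\<rbrace>) \<triangleleft> v') \<bullet> (c' \<bullet> (\<lbrace>y', z\<rbrace> \<triangleleft> z'))
    = (d \<triangleleft> w') \<bullet> (d' \<bullet> (c \<triangleleft> (x' \<cdot> v'))) \<bullet> ((\<lbrace>x', y \<cdot> z\<rbrace> \<triangleleft> v') \<bullet> c') \<bullet> (\<lbrace>y', z\<rbrace> \<triangleleft> z')"
    using C by (simp add: word_simps)
  also have "d' \<bullet> (c \<triangleleft> (x' \<cdot> v')) = (c \<triangleleft> w') \<bullet> d'"
    using C d' by (simp add: slide)
  also have "(\<lbrace>x', y \<cdot> z\<rbrace> \<triangleleft> v') \<bullet> c' = c' \<bullet> (\<lbrace>x', y \<cdot> z\<rbrace> \<triangleleft> (y' \<cdot> z'))"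
    using C c' by (simp add: slide)
  finally show ?thesis
    using C by (simp add: word_simps)
qed

text \<open>The right-hand side, in the same notation; its values of \<open>\<epsilon>\<close> are
  \<open>e : w \<rightarrow> u \<cdot> z\<close> and \<open>a : u \<rightarrow> x \<cdot> y\<close>. The braidings left over agree with those of the left-hand
  side by \<open>braid_mult_exchange\<close>.\<close>

lemma product_cocycle_right:
  assumes C: "x' \<in> Ob" "y \<in> Ob" "y' \<in> Ob" "u' \<in> Ob" "z \<in> Ob" "z' \<in> Ob" "w' \<in> Ob"
      "a \<in> Ar" "a' \<in> Ar" "e \<in> Ar" "e' \<in> Ar"
    and a': "u' \<cdot> \<partial> a' = x' \<cdot> y'" and e': "w' \<cdot> \<partial> e' = u' \<cdot> z'"
  shows "(e \<triangleleft> w') \<bullet> e' \<bullet> (\<lbrace>u', z\<rbrace> \<triangleleft> z') \<bullet> (((a \<triangleleft> u') \<bullet> a' \<bullet> (\<lbrace>x', y\<rbrace> \<triangleleft> y')) \<triangleleft> (z \<cdot> z'))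
    = ((e \<bullet> (a \<triangleleft> z)) \<triangleleft> w') \<bullet> (e' \<bullet> (a' \<triangleleft> z')) \<bullet> (((\<lbrace>x', y \<cdot> z\<rbrace> \<triangleleft> y') \<bullet> \<lbrace>y', z\<rbrace>) \<triangleleft> z')"
proof -
  have "(e \<triangleleft> w') \<bullet> e' \<bullet> (\<lbrace>u', z\<rbrace> \<triangleleft> z') \<bullet> (((a \<triangleleft> u') \<bullet> a' \<bullet> (\<lbrace>x', y\<rbrace> \<triangleleft> y')) \<triangleleft> (z \<cdot> z'))
    = (e \<triangleleft> w') \<bullet> e' \<bullet> ((\<lbrace>u', z\<rbrace> \<bullet> (a \<triangleleft> (u' \<cdot> z))) \<triangleleft> z') \<bullet> ((a' \<triangleleft> z \<bullet> (\<lbrace>x', y\<rbrace> \<triangleleft> (y' \<cdot> z))) \<triangleleft> z')"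
    using C by (simp add: word_simps)
  also have "\<lbrace>u', z\<rbrace> \<bullet> (a \<triangleleft> (u' \<cdot> z)) = (a \<triangleleft> (z \<cdot> u')) \<bullet> \<lbrace>u', z\<rbrace>"
    using C by (simp add: braid_slide)
  also have "(e \<triangleleft> w') \<bullet> e' \<bullet> (((a \<triangleleft> (z \<cdot> u')) \<bullet> \<lbrace>u', z\<rbrace>) \<triangleleft> z')
      \<bullet> ((a' \<triangleleft> z \<bullet> (\<lbrace>x', y\<rbrace> \<triangleleft> (y' \<cdot> z))) \<triangleleft> z')
    = (e \<triangleleft> w') \<bullet> (e' \<bullet> ((a \<triangleleft> z) \<triangleleft> (u' \<cdot> z')))
      \<bullet> (((\<lbrace>u', z\<rbrace> \<bullet> (a' \<triangleleft> z)) \<bullet> (\<lbrace>x', y\<rbrace> \<triangleleft> (y' \<cdot> z))) \<triangleleft> z')"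
    using C by (simp add: word_simps)
  also have "\<lbrace>u', z\<rbrace> \<bullet> (a' \<triangleleft> z) = a' \<bullet> \<lbrace>x' \<cdot> y', z\<rbrace>"
    using C a' by (simp add: braid_natural_left)
  also have "e' \<bullet> ((a \<triangleleft> z) \<triangleleft> (u' \<cdot> z')) = ((a \<triangleleft> z) \<triangleleft> w') \<bullet> e'"
    using C e' by (simp add: slide)
  also have "(a' \<bullet> \<lbrace>x' \<cdot> y', z\<rbrace>) \<bullet> (\<lbrace>x', y\<rbrace> \<triangleleft> (y' \<cdot> z))
      = a' \<bullet> ((\<lbrace>x', y \<cdot> z\<rbrace> \<triangleleft> y') \<bullet> \<lbrace>y', z\<rbrace>)"
    using C by (simp add: braid_mult_exchange K1.m_assoc)
  finally show ?thesis
    using C by (simp add: word_simps)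
qed

text \<open>Associativity of the product of \<open>Z\<^sup>1\<close> at a pair \<open>(\<sigma>, \<tau>)\<close>. Primes count the
  factors as above, and \<open>a, b, c\<close> are the values of the three twists. After sliding the first
  braiding past \<open>c\<close>, both sides contain the three pairwise braidings of the factors.\<close>

lemma product_assoc:
  assumes C: "u' \<in> Ob" "u'' \<in> Ob" "y \<in> Ob" "x' \<in> Ob" "y' \<in> Ob" "x'' \<in> Ob" "y'' \<in> Ob"
      "a \<in> Ar" "b \<in> Ar" "c \<in> Ar"
    and c: "u'' \<cdot> \<partial> c = x'' \<cdot> y''"
  shows "(((a \<triangleleft> u') \<bullet> b \<bullet> (\<lbrace>x', y\<rbrace> \<triangleleft> y')) \<triangleleft> u'') \<bullet> c \<bullet> (\<lbrace>x'', y \<cdot> y'\<rbrace> \<triangleleft> y'')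
    = (a \<triangleleft> (u' \<cdot> u'')) \<bullet> ((b \<triangleleft> u'') \<bullet> c \<bullet> (\<lbrace>x'', y'\<rbrace> \<triangleleft> y'')) \<bullet> (\<lbrace>x' \<cdot> x'', y\<rbrace> \<triangleleft> (y' \<cdot> y''))"
proof -
  have "(((a \<triangleleft> u') \<bullet> b \<bullet> (\<lbrace>x', y\<rbrace> \<triangleleft> y')) \<triangleleft> u'') \<bullet> c \<bullet> (\<lbrace>x'', y \<cdot> y'\<rbrace> \<triangleleft> y'')
    = (a \<triangleleft> (u' \<cdot> u'')) \<bullet> (b \<triangleleft> u'') \<bullet> (((\<lbrace>x', y\<rbrace> \<triangleleft> y') \<triangleleft> u'') \<bullet> c) \<bullet> (\<lbrace>x'', y \<cdot> y'\<rbrace> \<triangleleft> y'')"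
    using C by (simp add: word_simps)
  also have "((\<lbrace>x', y\<rbrace> \<triangleleft> y') \<triangleleft> u'') \<bullet> c = c \<bullet> ((\<lbrace>x', y\<rbrace> \<triangleleft> y') \<triangleleft> (x'' \<cdot> y''))"
    using C c by (intro slide) simp_all
  also have "(a \<triangleleft> (u' \<cdot> u'')) \<bullet> (b \<triangleleft> u'') \<bullet> (c \<bullet> ((\<lbrace>x', y\<rbrace> \<triangleleft> y') \<triangleleft> (x'' \<cdot> y''))) \<bullet> (\<lbrace>x'', y \<cdot> y'\<rbrace> \<triangleleft> y'')
    = (a \<triangleleft> (u' \<cdot> u'')) \<bullet> (b \<triangleleft> u'') \<bullet> c
      \<bullet> (((\<lbrace>x', y\<rbrace> \<triangleleft> (y' \<cdot> x'')) \<bullet> \<lbrace>x'', y'\<rbrace> \<bullet> (\<lbrace>x'', y\<rbrace> \<triangleleft> y')) \<triangleleft> y'')"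
    using C by (simp add: word_simps braid_mult_right)
  also have "(\<lbrace>x', y\<rbrace> \<triangleleft> (y' \<cdot> x'')) \<bullet> \<lbrace>x'', y'\<rbrace> = \<lbrace>x'', y'\<rbrace> \<bullet> (\<lbrace>x', y\<rbrace> \<triangleleft> (x'' \<cdot> y'))"
    using C by (simp add: braid_slide)
  finally show ?thesis
    using C by (simp add: word_simps braid_mult_left)
qed

text \<open>Multiplication on the right by a fixed cocycle (capital letters with a prime, with
  twist \<open>b\<close>) preserves the compatibility of an isomorphism with the twists. Here \<open>a\<close> and \<open>a2\<close> are
  the twists of the isomorphic cocycles, \<open>t, s, r\<close> stand for \<open>\<theta>(\<sigma>)\<close>, \<open>\<^sup>\<sigma>\<theta>(\<tau>)\<close>, \<open>\<theta>(\<sigma>\<tau>)\<close>, and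
  \<open>g1, g2\<close> for \<open>\<^sup>\<sigma>g\<close>, \<open>\<^sup>\<sigma>\<^sup>\<tau>g\<close>. The proof starts from the right-hand side, where the given
  compatibility can be applied once \<open>a\<close> has been moved next to \<open>r\<close>.\<close>

lemma iso_product_right:
  assumes C: "g1 \<in> Ob" "g2 \<in> Ob" "y \<in> Ob" "y2 \<in> Ob"
      "X' \<in> Ob" "Y' \<in> Ob" "U' \<in> Ob" "a \<in> Ar" "a2 \<in> Ar" "b \<in> Ar" "r \<in> Ar" "s \<in> Ar" "t \<in> Ar"
    and s: "y2 \<cdot> \<partial> s = inv0 g1 \<cdot> y \<cdot> g2" and b: "U' \<cdot> \<partial> b = X' \<cdot> Y'"
    and iso: "a2 \<bullet> (t \<triangleleft> y2) \<bullet> s = r \<bullet> (a \<triangleleft> g2)"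
  shows "((a2 \<triangleleft> U') \<bullet> b \<bullet> (\<lbrace>X', y2\<rbrace> \<triangleleft> Y'))
      \<bullet> (((t \<triangleleft> X') \<bullet> \<lbrace>X', g1\<rbrace>) \<triangleleft> (y2 \<cdot> Y')) \<bullet> ((s \<triangleleft> Y') \<bullet> \<lbrace>Y', g2\<rbrace>)
    = (r \<triangleleft> U') \<bullet> \<lbrace>U', g2\<rbrace> \<bullet> (((a \<triangleleft> U') \<bullet> b \<bullet> (\<lbrace>X', y\<rbrace> \<triangleleft> Y')) \<triangleleft> g2)"
    (is "?L = ?R")
proof -
  have s': "(g1 \<cdot> y2) \<cdot> \<partial> s = y \<cdot> g2"
    using C s by (simp add: word_simps)
  have "?R = (r \<triangleleft> U') \<bullet> (\<lbrace>U', g2\<rbrace> \<bullet> (a \<triangleleft> (U' \<cdot> g2))) \<bullet> (b \<triangleleft> g2) \<bullet> (\<lbrace>X', y\<rbrace> \<triangleleft> (Y' \<cdot> g2))"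
    using C by (simp add: word_simps)
  also have "\<lbrace>U', g2\<rbrace> \<bullet> (a \<triangleleft> (U' \<cdot> g2)) = (a \<triangleleft> (g2 \<cdot> U')) \<bullet> \<lbrace>U', g2\<rbrace>"
    using C by (simp add: braid_slide)
  also have "(r \<triangleleft> U') \<bullet> ((a \<triangleleft> (g2 \<cdot> U')) \<bullet> \<lbrace>U', g2\<rbrace>) \<bullet> (b \<triangleleft> g2) \<bullet> (\<lbrace>X', y\<rbrace> \<triangleleft> (Y' \<cdot> g2))
    = ((r \<bullet> (a \<triangleleft> g2)) \<triangleleft> U') \<bullet> (\<lbrace>U', g2\<rbrace> \<bullet> (b \<triangleleft> g2)) \<bullet> (\<lbrace>X', y\<rbrace> \<triangleleft> (Y' \<cdot> g2))"
    using C by (simp add: word_simps)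
  also have "\<lbrace>U', g2\<rbrace> \<bullet> (b \<triangleleft> g2) = b \<bullet> \<lbrace>X' \<cdot> Y', g2\<rbrace>"
    using C b by (simp add: braid_natural_left)
  also have "((r \<bullet> (a \<triangleleft> g2)) \<triangleleft> U') \<bullet> (b \<bullet> \<lbrace>X' \<cdot> Y', g2\<rbrace>) \<bullet> (\<lbrace>X', y\<rbrace> \<triangleleft> (Y' \<cdot> g2))
    = ((r \<bullet> (a \<triangleleft> g2)) \<triangleleft> U') \<bullet> b \<bullet> ((\<lbrace>X', y \<cdot> g2\<rbrace> \<triangleleft> Y') \<bullet> \<lbrace>Y', g2\<rbrace>)"
    using C by (simp add: braid_mult_exchange K1.m_assoc)
  also have "\<dots> = ((a2 \<bullet> (t \<triangleleft> y2)) \<triangleleft> U') \<bullet> ((s \<triangleleft> U') \<bullet> b) \<bullet> ((\<lbrace>X', y \<cdot> g2\<rbrace> \<triangleleft> Y') \<bullet> \<lbrace>Y', g2\<rbrace>)"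
    using C by (simp add: K1.m_assoc act.act_distrib flip: iso)
  also have "(s \<triangleleft> U') \<bullet> b = b \<bullet> (s \<triangleleft> (X' \<cdot> Y'))"
    using C b by (simp add: slide)
  also have "((a2 \<bullet> (t \<triangleleft> y2)) \<triangleleft> U') \<bullet> (b \<bullet> (s \<triangleleft> (X' \<cdot> Y'))) \<bullet> ((\<lbrace>X', y \<cdot> g2\<rbrace> \<triangleleft> Y') \<bullet> \<lbrace>Y', g2\<rbrace>)
    = ((a2 \<bullet> (t \<triangleleft> y2)) \<triangleleft> U') \<bullet> b \<bullet> (((s \<triangleleft> X') \<bullet> \<lbrace>X', y \<cdot> g2\<rbrace>) \<triangleleft> Y') \<bullet> \<lbrace>Y', g2\<rbrace>"
    using C by (simp add: word_simps)
  also have "(s \<triangleleft> X') \<bullet> \<lbrace>X', y \<cdot> g2\<rbrace> = \<lbrace>X', g1 \<cdot> y2\<rbrace> \<bullet> s"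
    using C s' by (simp add: braid_natural_right)
  also have "((a2 \<bullet> (t \<triangleleft> y2)) \<triangleleft> U') \<bullet> b \<bullet> ((\<lbrace>X', g1 \<cdot> y2\<rbrace> \<bullet> s) \<triangleleft> Y') \<bullet> \<lbrace>Y', g2\<rbrace>
    = (a2 \<triangleleft> U') \<bullet> (((t \<triangleleft> y2) \<triangleleft> U') \<bullet> b) \<bullet> ((\<lbrace>X', g1 \<cdot> y2\<rbrace> \<bullet> s) \<triangleleft> Y') \<bullet> \<lbrace>Y', g2\<rbrace>"
    using C by (simp add: word_simps)
  also have "((t \<triangleleft> y2) \<triangleleft> U') \<bullet> b = b \<bullet> ((t \<triangleleft> y2) \<triangleleft> (X' \<cdot> Y'))"
    using C b by (intro slide) simp_all
  also have "(a2 \<triangleleft> U') \<bullet> (b \<bullet> ((t \<triangleleft> y2) \<triangleleft> (X' \<cdot> Y'))) \<bullet> ((\<lbrace>X', g1 \<cdot> y2\<rbrace> \<bullet> s) \<triangleleft> Y') \<bullet> \<lbrace>Y', g2\<rbrace>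
    = (a2 \<triangleleft> U') \<bullet> b \<bullet> (((t \<triangleleft> (y2 \<cdot> X')) \<bullet> \<lbrace>X', y2\<rbrace>) \<triangleleft> Y') \<bullet> (\<lbrace>X', g1\<rbrace> \<triangleleft> (y2 \<cdot> Y'))
      \<bullet> (s \<triangleleft> Y') \<bullet> \<lbrace>Y', g2\<rbrace>"
    using C by (simp add: word_simps braid_mult_right)
  also have "(t \<triangleleft> (y2 \<cdot> X')) \<bullet> \<lbrace>X', y2\<rbrace> = \<lbrace>X', y2\<rbrace> \<bullet> (t \<triangleleft> (X' \<cdot> y2))"
    using C by (simp add: braid_slide)
  finally show ?thesis
    using C by (simp add: word_simps)
qed

text \<open>The analogue for multiplication on the left, with \<open>h0\<close> standing for \<open>g\<inverse>\<close>. This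
  time the inverse of \<open>g\<close>, not \<open>\<^sup>\<sigma>g\<close>, must be moved past the fixed cocycle. Both sides are
  brought to the form of the given compatibility followed by braidings.\<close>

lemma iso_product_left:
  assumes C: "g1 \<in> Ob" "g2 \<in> Ob" "h0 \<in> Ob"
      "x \<in> Ob" "y \<in> Ob" "u \<in> Ob" "x2 \<in> Ob" "y2 \<in> Ob" "u2 \<in> Ob"
      "X' \<in> Ob" "Y' \<in> Ob" "U' \<in> Ob" "a \<in> Ar" "a2 \<in> Ar" "b \<in> Ar" "r \<in> Ar" "s \<in> Ar" "t \<in> Ar"
    and t: "x2 \<cdot> \<partial> t = h0 \<cdot> x \<cdot> g1" and s: "y2 \<cdot> \<partial> s = inv0 g1 \<cdot> y \<cdot> g2"
    and r: "u2 \<cdot> \<partial> r = h0 \<cdot> u \<cdot> g2"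
    and a: "u \<cdot> \<partial> a = x \<cdot> y" and b: "U' \<cdot> \<partial> b = X' \<cdot> Y'"
    and iso: "a2 \<bullet> (t \<triangleleft> y2) \<bullet> s = r \<bullet> (a \<triangleleft> g2)"
  shows "((b \<triangleleft> u2) \<bullet> a2 \<bullet> (\<lbrace>x2, Y'\<rbrace> \<triangleleft> y2))
      \<bullet> ((t \<bullet> (\<lbrace>h0, X'\<rbrace> \<triangleleft> (x \<cdot> g1))) \<triangleleft> (Y' \<cdot> y2)) \<bullet> (s \<bullet> (\<lbrace>inv0 g1, Y'\<rbrace> \<triangleleft> (y \<cdot> g2)))
    = r \<bullet> (\<lbrace>h0, U'\<rbrace> \<triangleleft> (u \<cdot> g2)) \<bullet> (((b \<triangleleft> u) \<bullet> a \<bullet> (\<lbrace>x, Y'\<rbrace> \<triangleleft> y)) \<triangleleft> g2)"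
    (is "?L = ?R")
proof -
  let ?h1 = "inv0 g1"
  have "?R = r \<bullet> ((\<lbrace>h0, U'\<rbrace> \<bullet> b) \<triangleleft> (u \<cdot> g2)) \<bullet> ((a \<bullet> (\<lbrace>x, Y'\<rbrace> \<triangleleft> y)) \<triangleleft> g2)"
    using C by (simp add: word_simps)
  also have "\<lbrace>h0, U'\<rbrace> \<bullet> b = (b \<triangleleft> h0) \<bullet> \<lbrace>h0, X' \<cdot> Y'\<rbrace>"
    using C b by (simp add: braid_natural_right)
  also have "r \<bullet> (((b \<triangleleft> h0) \<bullet> \<lbrace>h0, X' \<cdot> Y'\<rbrace>) \<triangleleft> (u \<cdot> g2)) \<bullet> ((a \<bullet> (\<lbrace>x, Y'\<rbrace> \<triangleleft> y)) \<triangleleft> g2)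
    = (r \<bullet> (b \<triangleleft> (h0 \<cdot> u \<cdot> g2))) \<bullet> (((\<lbrace>h0, X' \<cdot> Y'\<rbrace> \<triangleleft> u) \<bullet> a) \<triangleleft> g2) \<bullet> (\<lbrace>x, Y'\<rbrace> \<triangleleft> (y \<cdot> g2))"
    using C by (simp add: word_simps)
  also have "r \<bullet> (b \<triangleleft> (h0 \<cdot> u \<cdot> g2)) = (b \<triangleleft> u2) \<bullet> r"
    using C r by (simp add: slide)
  also have "(\<lbrace>h0, X' \<cdot> Y'\<rbrace> \<triangleleft> u) \<bullet> a = a \<bullet> (\<lbrace>h0, X' \<cdot> Y'\<rbrace> \<triangleleft> (x \<cdot> y))"
    using C a by (simp add: slide)
  also have "((b \<triangleleft> u2) \<bullet> r) \<bullet> ((a \<bullet> (\<lbrace>h0, X' \<cdot> Y'\<rbrace> \<triangleleft> (x \<cdot> y))) \<triangleleft> g2) \<bullet> (\<lbrace>x, Y'\<rbrace> \<triangleleft> (y \<cdot> g2))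
    = (b \<triangleleft> u2) \<bullet> (r \<bullet> (a \<triangleleft> g2)) \<bullet> (((\<lbrace>h0, X' \<cdot> Y'\<rbrace> \<triangleleft> x) \<bullet> \<lbrace>x, Y'\<rbrace>) \<triangleleft> (y \<cdot> g2))"
    using C by (simp add: word_simps)
  also have "(\<lbrace>h0, X' \<cdot> Y'\<rbrace> \<triangleleft> x) \<bullet> \<lbrace>x, Y'\<rbrace> = \<lbrace>h0 \<cdot> x, Y'\<rbrace> \<bullet> (\<lbrace>h0, X'\<rbrace> \<triangleleft> (x \<cdot> Y'))"
    using C by (simp add: braid_mult_exchange)
  finally have R: "?R = (b \<triangleleft> u2) \<bullet> (r \<bullet> (a \<triangleleft> g2))
      \<bullet> ((\<lbrace>h0 \<cdot> x, Y'\<rbrace> \<bullet> (\<lbrace>h0, X'\<rbrace> \<triangleleft> (x \<cdot> Y'))) \<triangleleft> (y \<cdot> g2))" .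
  have "?L = (b \<triangleleft> u2) \<bullet> a2 \<bullet> ((\<lbrace>x2, Y'\<rbrace> \<bullet> (t \<triangleleft> Y') \<bullet> (\<lbrace>h0, X'\<rbrace> \<triangleleft> (x \<cdot> g1 \<cdot> Y'))) \<triangleleft> y2)
      \<bullet> (s \<bullet> (\<lbrace>?h1, Y'\<rbrace> \<triangleleft> (y \<cdot> g2)))"
    using C by (simp add: word_simps)
  also have "\<lbrace>x2, Y'\<rbrace> \<bullet> (t \<triangleleft> Y') = t \<bullet> \<lbrace>h0 \<cdot> x \<cdot> g1, Y'\<rbrace>"
    using C t by (simp add: braid_natural_left)
  also have "(b \<triangleleft> u2) \<bullet> a2 \<bullet> ((t \<bullet> \<lbrace>h0 \<cdot> x \<cdot> g1, Y'\<rbrace> \<bullet> (\<lbrace>h0, X'\<rbrace> \<triangleleft> (x \<cdot> g1 \<cdot> Y'))) \<triangleleft> y2)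
      \<bullet> (s \<bullet> (\<lbrace>?h1, Y'\<rbrace> \<triangleleft> (y \<cdot> g2)))
    = (b \<triangleleft> u2) \<bullet> a2 \<bullet> (t \<triangleleft> y2)
      \<bullet> (((\<lbrace>h0 \<cdot> x \<cdot> g1, Y'\<rbrace> \<bullet> (\<lbrace>h0, X'\<rbrace> \<triangleleft> (x \<cdot> g1 \<cdot> Y'))) \<triangleleft> y2) \<bullet> s)
      \<bullet> (\<lbrace>?h1, Y'\<rbrace> \<triangleleft> (y \<cdot> g2))"
    using C by (simp add: K1.m_assoc act.act_distrib)
  also have "((\<lbrace>h0 \<cdot> x \<cdot> g1, Y'\<rbrace> \<bullet> (\<lbrace>h0, X'\<rbrace> \<triangleleft> (x \<cdot> g1 \<cdot> Y'))) \<triangleleft> y2) \<bullet> s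
    = s \<bullet> ((\<lbrace>h0 \<cdot> x \<cdot> g1, Y'\<rbrace> \<bullet> (\<lbrace>h0, X'\<rbrace> \<triangleleft> (x \<cdot> g1 \<cdot> Y'))) \<triangleleft> (?h1 \<cdot> y \<cdot> g2))"
    using C s by (intro slide) simp_all
  also have "(b \<triangleleft> u2) \<bullet> a2 \<bullet> (t \<triangleleft> y2)
      \<bullet> (s \<bullet> ((\<lbrace>h0 \<cdot> x \<cdot> g1, Y'\<rbrace> \<bullet> (\<lbrace>h0, X'\<rbrace> \<triangleleft> (x \<cdot> g1 \<cdot> Y'))) \<triangleleft> (?h1 \<cdot> y \<cdot> g2)))
      \<bullet> (\<lbrace>?h1, Y'\<rbrace> \<triangleleft> (y \<cdot> g2))
    = (b \<triangleleft> u2) \<bullet> (a2 \<bullet> (t \<triangleleft> y2) \<bullet> s)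
      \<bullet> (((\<lbrace>h0 \<cdot> x \<cdot> g1, Y'\<rbrace> \<triangleleft> ?h1) \<bullet> (((\<lbrace>h0, X'\<rbrace> \<triangleleft> (x \<cdot> g1)) \<triangleleft> (Y' \<cdot> ?h1)) \<bullet> \<lbrace>?h1, Y'\<rbrace>))
        \<triangleleft> (y \<cdot> g2))"
    using C by (simp add: word_simps)
  also have "((\<lbrace>h0, X'\<rbrace> \<triangleleft> (x \<cdot> g1)) \<triangleleft> (Y' \<cdot> ?h1)) \<bullet> \<lbrace>?h1, Y'\<rbrace>
    = \<lbrace>?h1, Y'\<rbrace> \<bullet> ((\<lbrace>h0, X'\<rbrace> \<triangleleft> (x \<cdot> g1)) \<triangleleft> (?h1 \<cdot> Y'))"
    using C by (intro braid_slide) simp_all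
  also have "(\<lbrace>h0 \<cdot> x \<cdot> g1, Y'\<rbrace> \<triangleleft> ?h1)
      \<bullet> (\<lbrace>?h1, Y'\<rbrace> \<bullet> ((\<lbrace>h0, X'\<rbrace> \<triangleleft> (x \<cdot> g1)) \<triangleleft> (?h1 \<cdot> Y')))
    = \<lbrace>h0 \<cdot> x \<cdot> g1 \<cdot> ?h1, Y'\<rbrace> \<bullet> (\<lbrace>h0, X'\<rbrace> \<triangleleft> (x \<cdot> Y'))"
    using C braid_mult_left[of "h0 \<cdot> x \<cdot> g1" ?h1 Y'] by (simp add: word_simps flip: K1.m_assoc)
  also have "h0 \<cdot> x \<cdot> g1 \<cdot> ?h1 = h0 \<cdot> x"
    using C by (simp add: word_simps)
  finally show ?thesis
    using R iso by simp
qed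

end

section \<open>The group \<open>Z\<^sup>0\<close> and the abelian group \<open>H\<^sup>0\<close>\<close>

context gamma_crossed_module
begin

text \<open>That \<open>\<theta>\<close> is pointed follows from the cocycle identity at \<open>(\<one>, \<one>)\<close>.\<close>

lemma Z0_iff:
  "(g, \<theta>) \<in> carrier (Z0 X) \<longleftrightarrow> g \<in> Ob \<and> \<theta> \<in> \<Gamma> \<rightarrow>\<^sub>E Ar
    \<and> (\<forall>\<sigma>\<in>\<Gamma>. \<partial> (\<theta> \<sigma>) = inv0 g \<cdot> \<sigma> \<rightharpoonup> g)
    \<and> (\<forall>\<sigma>\<in>\<Gamma>. \<forall>\<tau>\<in>\<Gamma>. \<theta> (\<sigma> \<star> \<tau>) = \<theta> \<sigma> \<bullet> \<sigma> \<rightharpoondown> \<theta> \<tau>)" (is "_ \<longleftrightarrow> ?Q")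
proof
  assume ?Q
  then have "\<theta> \<one>\<^sub>\<Gamma> \<in> Ar" "\<theta> (\<one>\<^sub>\<Gamma> \<star> \<one>\<^sub>\<Gamma>) = \<theta> \<one>\<^sub>\<Gamma> \<bullet> \<one>\<^sub>\<Gamma> \<rightharpoondown> \<theta> \<one>\<^sub>\<Gamma>"
    by blast+
  then have "\<theta> \<one>\<^sub>\<Gamma> = \<one>\<^sub>1"
    by simp
  with \<open>?Q\<close> show "(g, \<theta>) \<in> carrier (Z0 X)"
    by (simp add: Z0_def C0_def)
qed (simp add: Z0_def C0_def)

lemma Z0D:
  assumes "(g, \<theta>) \<in> carrier (Z0 X)"
  shows "g \<in> Ob" and "\<theta> \<in> extensional \<Gamma>"
    and "\<sigma> \<in> \<Gamma> \<Longrightarrow> \<theta> \<sigma> \<in> Ar"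
    and "\<sigma> \<in> \<Gamma> \<Longrightarrow> \<partial> (\<theta> \<sigma>) = inv0 g \<cdot> \<sigma> \<rightharpoonup> g"
    and "\<lbrakk>\<sigma> \<in> \<Gamma>; \<tau> \<in> \<Gamma>\<rbrakk> \<Longrightarrow> \<theta> (\<sigma> \<star> \<tau>) = \<theta> \<sigma> \<bullet> \<sigma> \<rightharpoondown> \<theta> \<tau>"
  using assms by (auto simp: Z0_iff PiE_def)

lemma Z0_mult:
  "(g, \<theta>) \<otimes>\<^bsub>Z0 X\<^esub> (h, \<phi>) = (g \<cdot> h, \<lambda>\<sigma>\<in>\<Gamma>. (\<theta> \<sigma> \<triangleleft> h) \<bullet> \<phi> \<sigma>)"
  by (simp add: Z0_def)

lemma Z0_one: "\<one>\<^bsub>Z0 X\<^esub> = (\<one>\<^sub>0, \<lambda>\<sigma>\<in>\<Gamma>. \<one>\<^sub>1)"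
  by (simp add: Z0_def)

lemma Z0_mult_closed:
  assumes c: "(g, \<theta>) \<in> carrier (Z0 X)" and d: "(h, \<phi>) \<in> carrier (Z0 X)"
  shows "(g, \<theta>) \<otimes>\<^bsub>Z0 X\<^esub> (h, \<phi>) \<in> carrier (Z0 X)"
proof -
  have "(\<theta> (\<sigma> \<star> \<tau>) \<triangleleft> h) \<bullet> \<phi> (\<sigma> \<star> \<tau>) = (\<theta> \<sigma> \<triangleleft> h) \<bullet> \<phi> \<sigma> \<bullet> \<sigma> \<rightharpoondown> ((\<theta> \<tau> \<triangleleft> h) \<bullet> \<phi> \<tau>)"
    if "\<sigma> \<in> \<Gamma>" "\<tau> \<in> \<Gamma>" for \<sigma> \<tau>
  proof -
    have "(\<theta> (\<sigma> \<star> \<tau>) \<triangleleft> h) \<bullet> \<phi> (\<sigma> \<star> \<tau>)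
        = (\<theta> \<sigma> \<triangleleft> h) \<bullet> (((\<sigma> \<rightharpoondown> \<theta> \<tau>) \<triangleleft> h) \<bullet> \<phi> \<sigma>) \<bullet> \<sigma> \<rightharpoondown> \<phi> \<tau>"
      using that Z0D[OF c] Z0D[OF d] by (simp add: word_simps)
    also have "((\<sigma> \<rightharpoondown> \<theta> \<tau>) \<triangleleft> h) \<bullet> \<phi> \<sigma> = \<phi> \<sigma> \<bullet> ((\<sigma> \<rightharpoondown> \<theta> \<tau>) \<triangleleft> \<sigma> \<rightharpoonup> h)"
      using that Z0D[OF c] Z0D[OF d] by (intro slide) simp_all
    finally show ?thesis
      using that Z0D[OF c] Z0D[OF d] by (simp add: word_simps)
  qed
  then show ?thesis
    using Z0D[OF c] Z0D[OF d] by (auto simp: Z0_mult Z0_iff bd_ract word_simps)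
qed

lemma Z0_left_inverse:
  assumes c: "(g, \<theta>) \<in> carrier (Z0 X)"
  defines "d \<equiv> (inv0 g, \<lambda>\<sigma>\<in>\<Gamma>. inv1 (\<theta> \<sigma>) \<triangleleft> inv0 g)"
  shows "d \<in> carrier (Z0 X)" and "d \<otimes>\<^bsub>Z0 X\<^esub> (g, \<theta>) = \<one>\<^bsub>Z0 X\<^esub>"
proof -
  have "inv1 (\<theta> (\<sigma> \<star> \<tau>)) \<triangleleft> inv0 g = (inv1 (\<theta> \<sigma>) \<triangleleft> inv0 g) \<bullet> \<sigma> \<rightharpoondown> (inv1 (\<theta> \<tau>) \<triangleleft> inv0 g)"
    if "\<sigma> \<in> \<Gamma>" "\<tau> \<in> \<Gamma>" for \<sigma> \<tau>
  proof -
    have "inv1 (\<theta> (\<sigma> \<star> \<tau>)) \<triangleleft> inv0 g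
        = (\<sigma> \<rightharpoondown> inv1 (\<theta> \<tau>) \<triangleleft> inv0 g) \<bullet> (inv1 (\<theta> \<sigma>) \<triangleleft> inv0 g)"
      using that Z0D[OF c] by (simp add: word_simps)
    also have "\<dots> = (inv1 (\<theta> \<sigma>) \<triangleleft> inv0 g) \<bullet> (\<sigma> \<rightharpoondown> inv1 (\<theta> \<tau>) \<triangleleft> \<sigma> \<rightharpoonup> inv0 g)"
      using that Z0D[OF c] by (intro slide) (simp_all add: bd_ract word_simps)
    finally show ?thesis
      using that Z0D[OF c] by simp
  qed
  then show "d \<in> carrier (Z0 X)"
    using Z0D[OF c] by (auto simp: d_def Z0_iff bd_ract word_simps)
  show "d \<otimes>\<^bsub>Z0 X\<^esub> (g, \<theta>) = \<one>\<^bsub>Z0 X\<^esub>"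
    using Z0D[OF c] by (auto simp: d_def Z0_mult Z0_one word_simps intro!: restrict_ext)
qed

sublocale Z0: group "Z0 X"
proof (rule groupI, goal_cases)
  case (1 c d)
  then show ?case by (cases c; cases d) (simp add: Z0_mult_closed)
next
  case 2
  show ?case by (simp add: Z0_one Z0_iff)
next
  case (3 c d e)
  then show ?case
    by (cases c; cases d; cases e) (auto simp: Z0_mult Z0D word_simps intro!: restrict_ext)
next
  case (4 c)
  obtain g \<theta> where c: "c = (g, \<theta>)" by fastforce
  then show ?case
    using 4 Z0D[of g \<theta>] by (auto simp: Z0_mult Z0_one intro: extensionalityI)
next
  case (5 c)
  obtain g \<theta> where "c = (g, \<theta>)" by fastforce
  then show ?case
    using 5 Z0_left_inverse[of g \<theta>] by blast
qed

definition coboundary where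
  "coboundary \<mu> = (\<partial> \<mu>, \<lambda>\<sigma>\<in>\<Gamma>. inv1 \<mu> \<bullet> \<sigma> \<rightharpoondown> \<mu>)"

lemma B0_eq: "B0 X = coboundary ` Ar"
  by (auto simp: B0_def coboundary_def)

lemma coboundary_closed [simp]: "\<mu> \<in> Ar \<Longrightarrow> coboundary \<mu> \<in> carrier (Z0 X)"
  by (auto simp: coboundary_def Z0_iff word_simps)

lemma coboundary_mult:
  "\<lbrakk>\<mu> \<in> Ar; \<nu> \<in> Ar\<rbrakk> \<Longrightarrow> coboundary (\<mu> \<bullet> \<nu>) = coboundary \<mu> \<otimes>\<^bsub>Z0 X\<^esub> coboundary \<nu>"
  by (auto simp: coboundary_def Z0_mult ract_bd word_simps intro!: restrict_ext)

lemma B0_subgroup: "subgroup (B0 X) (Z0 X)"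
proof -
  have "group_hom (G1 X) (Z0 X) coboundary"
    using K1.is_group Z0.is_group
    by (auto intro!: group_hom.intro group_hom_axioms.intro simp: hom_def coboundary_mult)
  then show ?thesis
    using group_hom.img_is_subgroup by (fastforce simp: B0_eq)
qed

text \<open>The conjugation formula that makes \<open>B\<^sup>0\<close> normal.\<close>

lemma coboundary_commute:
  assumes c: "(g, \<theta>) \<in> carrier (Z0 X)" and \<mu>: "\<mu> \<in> Ar"
  shows "(g, \<theta>) \<otimes>\<^bsub>Z0 X\<^esub> coboundary (\<mu> \<triangleleft> g) = coboundary \<mu> \<otimes>\<^bsub>Z0 X\<^esub> (g, \<theta>)"
proof -
  have "(\<theta> \<sigma> \<triangleleft> \<partial> (\<mu> \<triangleleft> g)) \<bullet> (inv1 (\<mu> \<triangleleft> g) \<bullet> \<sigma> \<rightharpoondown> (\<mu> \<triangleleft> g))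
      = ((inv1 \<mu> \<bullet> \<sigma> \<rightharpoondown> \<mu>) \<triangleleft> g) \<bullet> \<theta> \<sigma>" if "\<sigma> \<in> \<Gamma>" for \<sigma>
  proof -
    have "((\<sigma> \<rightharpoondown> \<mu>) \<triangleleft> g) \<bullet> \<theta> \<sigma> = \<theta> \<sigma> \<bullet> ((\<sigma> \<rightharpoondown> \<mu>) \<triangleleft> \<sigma> \<rightharpoonup> g)"
      using that Z0D[OF c] \<mu> by (intro slide) simp_all
    then show ?thesis
      using that Z0D[OF c] \<mu> by (simp add: ract_bd word_simps del: bd_ract)
  qed
  then show ?thesis
    using Z0D[OF c] \<mu> by (auto simp: coboundary_def Z0_mult bd_ract word_simps intro!: restrict_ext)
qed

sublocale B0: normal "B0 X" "Z0 X"
proof -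
  have "inv\<^bsub>Z0 X\<^esub> c \<otimes>\<^bsub>Z0 X\<^esub> b \<otimes>\<^bsub>Z0 X\<^esub> c \<in> B0 X"
    if c: "c \<in> carrier (Z0 X)" and b: "b \<in> B0 X" for b c
  proof -
    obtain g \<theta> \<mu> where "c = (g, \<theta>)" "b = coboundary \<mu>" "\<mu> \<in> Ar" "g \<in> Ob"
      using b c by (cases c) (auto simp: B0_eq Z0D)
    then have "b \<otimes>\<^bsub>Z0 X\<^esub> c = c \<otimes>\<^bsub>Z0 X\<^esub> coboundary (\<mu> \<triangleleft> g)" "\<mu> \<triangleleft> g \<in> Ar"
      using c coboundary_commute by auto
    then show ?thesis
      using c b by (auto simp: B0_eq Z0.m_assoc)
  qed
  then have "c \<otimes>\<^bsub>Z0 X\<^esub> b \<otimes>\<^bsub>Z0 X\<^esub> inv\<^bsub>Z0 X\<^esub> c \<in> B0 X"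
    if "c \<in> carrier (Z0 X)" "b \<in> B0 X" for b c
    using that by (metis Z0.inv_closed Z0.inv_inv)
  then show "normal (B0 X) (Z0 X)"
    unfolding Z0.normal_inv_iff using B0_subgroup by blast
qed

lemma B0_coset_mult_coboundary:
  assumes c: "c \<in> carrier (Z0 X)" and \<mu>: "\<mu> \<in> Ar"
  shows "B0 X #>\<^bsub>Z0 X\<^esub> (c \<otimes>\<^bsub>Z0 X\<^esub> coboundary \<mu>) = B0 X #>\<^bsub>Z0 X\<^esub> c"
proof -
  obtain g \<theta> where cg: "c = (g, \<theta>)" by fastforce
  \<comment> \<open>Chosen so that conjugating the coboundary of \<open>\<nu>\<close> by \<open>c\<close> gives that of \<open>\<mu>\<close>.\<close>
  define \<nu> where "\<nu> = \<mu> \<triangleleft> inv0 g"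
  have \<nu>: "\<nu> \<in> Ar" "\<nu> \<triangleleft> g = \<mu>"
    using Z0D(1)[of g \<theta>] c \<mu> by (simp_all add: cg \<nu>_def word_simps)
  then have "c \<otimes>\<^bsub>Z0 X\<^esub> coboundary \<mu> = coboundary \<nu> \<otimes>\<^bsub>Z0 X\<^esub> c"
    using coboundary_commute[of g \<theta> \<nu>] c by (simp add: cg)
  then have "c \<otimes>\<^bsub>Z0 X\<^esub> coboundary \<mu> \<in> B0 X #>\<^bsub>Z0 X\<^esub> c"
    using \<nu> by (auto simp: r_coset_def B0_eq)
  from Z0.repr_independence[OF this c B0_subgroup] show ?thesis ..
qed

end

context braided_crossed_module
begin

text \<open>The second components differ by naturality of the braiding along the arrows
  \<open>\<theta>(\<sigma>) : g \<rightarrow> \<^sup>\<sigma>g\<close> and \<open>\<phi>(\<sigma>) : h \<rightarrow> \<^sup>\<sigma>h\<close>, because \<open>{\<^sup>\<sigma>g, \<^sup>\<sigma>h} = \<^sup>\<sigma>{g, h}\<close>.\<close>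

lemma Z0_commute_up_to_coboundary:
  assumes c: "(g, \<theta>) \<in> carrier (Z0 X)" and d: "(h, \<phi>) \<in> carrier (Z0 X)"
  shows "(g, \<theta>) \<otimes>\<^bsub>Z0 X\<^esub> (h, \<phi>)
    = (h, \<phi>) \<otimes>\<^bsub>Z0 X\<^esub> (g, \<theta>) \<otimes>\<^bsub>Z0 X\<^esub> coboundary \<lbrace>g, h\<rbrace>"
proof -
  have "(\<theta> \<sigma> \<triangleleft> h) \<bullet> \<phi> \<sigma>
      = (((\<phi> \<sigma> \<triangleleft> g) \<bullet> \<theta> \<sigma>) \<triangleleft> \<partial> \<lbrace>g, h\<rbrace>) \<bullet> (inv1 \<lbrace>g, h\<rbrace> \<bullet> \<sigma> \<rightharpoondown> \<lbrace>g, h\<rbrace>)"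
    if "\<sigma> \<in> \<Gamma>" for \<sigma>
  proof -
    have "(\<theta> \<sigma> \<triangleleft> h) \<bullet> \<phi> \<sigma> = inv1 \<lbrace>g, h\<rbrace> \<bullet> (\<lbrace>g, h\<rbrace> \<bullet> (\<theta> \<sigma> \<triangleleft> h) \<bullet> \<phi> \<sigma>)"
      using that Z0D[OF c] Z0D[OF d] by (simp add: K1.m_assoc)
    also have "\<lbrace>g, h\<rbrace> \<bullet> (\<theta> \<sigma> \<triangleleft> h) \<bullet> \<phi> \<sigma> = (\<phi> \<sigma> \<triangleleft> g) \<bullet> \<theta> \<sigma> \<bullet> \<sigma> \<rightharpoondown> \<lbrace>g, h\<rbrace>"
      using that Z0D[OF c] Z0D[OF d] by (simp add: braid_natural)
    finally show ?thesis
      using that Z0D[OF c] Z0D[OF d] by (simp add: ract_bd K1.m_assoc)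
  qed
  moreover have "g \<cdot> h = h \<cdot> g \<cdot> \<partial> \<lbrace>g, h\<rbrace>"
    using Z0D(1)[OF c] Z0D(1)[OF d] by (simp add: mult_bd_braid word_simps)
  ultimately show ?thesis
    by (auto simp: coboundary_def Z0_mult intro!: restrict_ext)
qed

lemma H0_comm_group: "comm_group (H0 X)"
proof -
  have "B0 X #>\<^bsub>Z0 X\<^esub> (c \<otimes>\<^bsub>Z0 X\<^esub> d) = B0 X #>\<^bsub>Z0 X\<^esub> (d \<otimes>\<^bsub>Z0 X\<^esub> c)"
    if "c \<in> carrier (Z0 X)" "d \<in> carrier (Z0 X)" for c d
  proof -
    obtain g \<theta> h \<phi> where cd: "c = (g, \<theta>)" "d = (h, \<phi>)"
      by fastforce
    then have "\<lbrace>g, h\<rbrace> \<in> Ar"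
      using that Z0D(1)[of g \<theta>] Z0D(1)[of h \<phi>] by simp
    with cd show ?thesis
      using that Z0_commute_up_to_coboundary[of g \<theta> h \<phi>] B0_coset_mult_coboundary
      by (metis Z0.m_closed)
  qed
  then show ?thesis
    unfolding H0_def
    by (intro group.group_comm_groupI B0.factorgroup_is_group)
      (auto simp: carrier_FactGroup B0.rcos_sum)
qed

end

section \<open>The group \<open>Z\<^sup>1\<close>\<close>

context gamma_crossed_module
begin

text \<open>The conditions on a cocycle apart from the cocycle identity itself. The identity is kept
  separate because inverses in \<open>Z\<^sup>1\<close> are first constructed as twisted maps and only then shown to
  satisfy it.\<close>

definition twisted_map where
  "twisted_map p \<epsilon> \<longleftrightarrow> p \<in> \<Gamma> \<rightarrow>\<^sub>E Ob \<and> p \<one>\<^sub>\<Gamma> = \<one>\<^sub>0 \<and> \<epsilon> \<in> \<Gamma> \<times> \<Gamma> \<rightarrow>\<^sub>E Ar \<and> \<epsilon> (\<one>\<^sub>\<Gamma>, \<one>\<^sub>\<Gamma>) = \<one>\<^sub>1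
    \<and> (\<forall>\<sigma>\<in>\<Gamma>. \<forall>\<tau>\<in>\<Gamma>. p (\<sigma> \<star> \<tau>) \<cdot> \<partial> (\<epsilon> (\<sigma>, \<tau>)) = p \<sigma> \<cdot> \<sigma> \<rightharpoonup> p \<tau>)"

definition cocycle_at where
  "cocycle_at p \<epsilon> \<sigma> \<tau> \<upsilon> \<longleftrightarrow>
    \<epsilon> (\<sigma>, \<tau> \<star> \<upsilon>) \<bullet> \<sigma> \<rightharpoondown> \<epsilon> (\<tau>, \<upsilon>) = \<epsilon> (\<sigma> \<star> \<tau>, \<upsilon>) \<bullet> (\<epsilon> (\<sigma>, \<tau>) \<triangleleft> \<sigma> \<rightharpoonup> \<tau> \<rightharpoonup> p \<upsilon>)"

lemma twisted_mapD:
  assumes "twisted_map p \<epsilon>"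
  shows "p \<in> extensional \<Gamma>" and "\<epsilon> \<in> extensional (\<Gamma> \<times> \<Gamma>)"
    and "\<sigma> \<in> \<Gamma> \<Longrightarrow> p \<sigma> \<in> Ob" and "\<lbrakk>\<sigma> \<in> \<Gamma>; \<tau> \<in> \<Gamma>\<rbrakk> \<Longrightarrow> \<epsilon> (\<sigma>, \<tau>) \<in> Ar"
    and "p \<one>\<^sub>\<Gamma> = \<one>\<^sub>0" and "\<epsilon> (\<one>\<^sub>\<Gamma>, \<one>\<^sub>\<Gamma>) = \<one>\<^sub>1"
    and "\<lbrakk>\<sigma> \<in> \<Gamma>; \<tau> \<in> \<Gamma>\<rbrakk> \<Longrightarrow> p (\<sigma> \<star> \<tau>) \<cdot> \<partial> (\<epsilon> (\<sigma>, \<tau>)) = p \<sigma> \<cdot> \<sigma> \<rightharpoonup> p \<tau>"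
  using assms by (auto simp: twisted_map_def PiE_def Pi_def)

lemma Z1_set_iff:
  "(p, \<epsilon>) \<in> Z1_set X
    \<longleftrightarrow> twisted_map p \<epsilon> \<and> (\<forall>\<sigma>\<in>\<Gamma>. \<forall>\<tau>\<in>\<Gamma>. \<forall>\<upsilon>\<in>\<Gamma>. cocycle_at p \<epsilon> \<sigma> \<tau> \<upsilon>)"
proof -
  have "(\<sigma> \<star> \<tau>) \<rightharpoonup> p \<upsilon> = \<sigma> \<rightharpoonup> \<tau> \<rightharpoonup> p \<upsilon>"
    if "twisted_map p \<epsilon>" "\<sigma> \<in> \<Gamma>" "\<tau> \<in> \<Gamma>" "\<upsilon> \<in> \<Gamma>" for \<sigma> \<tau> \<upsilon>
    using that by (simp add: twisted_mapD(3))
  then show ?thesis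
    by (auto simp: Z1_set_def twisted_map_def cocycle_at_def)
qed

lemma Z1_set_cases:
  assumes "z \<in> Z1_set X"
  obtains p \<epsilon> where "z = (p, \<epsilon>)" "twisted_map p \<epsilon>"
    "\<And>\<sigma> \<tau> \<upsilon>. \<lbrakk>\<sigma> \<in> \<Gamma>; \<tau> \<in> \<Gamma>; \<upsilon> \<in> \<Gamma>\<rbrakk> \<Longrightarrow> cocycle_at p \<epsilon> \<sigma> \<tau> \<upsilon>"
  using assms by (cases z) (auto simp: Z1_set_iff)

end

context braided_crossed_module
begin

lemma braid_inv_right:
  assumes "g \<in> Ob" "h \<in> Ob"
  shows "\<lbrace>g, inv0 h\<rbrace> \<triangleleft> h = inv1 \<lbrace>g, h\<rbrace>"
proof -
  have "\<lbrace>g, h\<rbrace> \<bullet> (\<lbrace>g, inv0 h\<rbrace> \<triangleleft> h) = \<one>\<^sub>1"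
    using braid_mult_right[of g "inv0 h" h] assms by simp
  then show ?thesis
    using assms by (metis K1.inv_comm K1.inv_equality act.act_closed braid_closed K0.inv_closed)
qed

definition product_map where
  "product_map p q = (\<lambda>\<sigma>\<in>\<Gamma>. p \<sigma> \<cdot> q \<sigma>)"

definition product_twist where
  "product_twist p \<epsilon> q \<eta> = (\<lambda>(\<sigma>, \<tau>)\<in>\<Gamma> \<times> \<Gamma>.
    (\<epsilon> (\<sigma>, \<tau>) \<triangleleft> q (\<sigma> \<star> \<tau>)) \<bullet> \<eta> (\<sigma>, \<tau>) \<bullet> (\<lbrace>q \<sigma>, \<sigma> \<rightharpoonup> p \<tau>\<rbrace> \<triangleleft> \<sigma> \<rightharpoonup> q \<tau>))"

lemma Z1_simps:
  "carrier (Z1 X) = Z1_set X"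
  "(p, \<epsilon>) \<otimes>\<^bsub>Z1 X\<^esub> (q, \<eta>) = (product_map p q, product_twist p \<epsilon> q \<eta>)"
  "\<one>\<^bsub>Z1 X\<^esub> = (\<lambda>\<sigma>\<in>\<Gamma>. \<one>\<^sub>0, \<lambda>_\<in>\<Gamma> \<times> \<Gamma>. \<one>\<^sub>1)"
  by (simp_all add: Z1_def product_map_def product_twist_def)

lemma product_map_apply [simp]: "\<sigma> \<in> \<Gamma> \<Longrightarrow> product_map p q \<sigma> = p \<sigma> \<cdot> q \<sigma>"
  by (simp add: product_map_def)

lemma product_twist_apply [simp]:
  "\<lbrakk>\<sigma> \<in> \<Gamma>; \<tau> \<in> \<Gamma>\<rbrakk> \<Longrightarrow> product_twist p \<epsilon> q \<eta> (\<sigma>, \<tau>)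
    = (\<epsilon> (\<sigma>, \<tau>) \<triangleleft> q (\<sigma> \<star> \<tau>)) \<bullet> \<eta> (\<sigma>, \<tau>) \<bullet> (\<lbrace>q \<sigma>, \<sigma> \<rightharpoonup> p \<tau>\<rbrace> \<triangleleft> \<sigma> \<rightharpoonup> q \<tau>)"
  by (simp add: product_twist_def)

lemma twisted_map_product:
  assumes z: "twisted_map p \<epsilon>" and w: "twisted_map q \<eta>"
  shows "twisted_map (product_map p q) (product_twist p \<epsilon> q \<eta>)"
proof -
  have "product_map p q (\<sigma> \<star> \<tau>) \<cdot> \<partial> (product_twist p \<epsilon> q \<eta> (\<sigma>, \<tau>))
      = product_map p q \<sigma> \<cdot> \<sigma> \<rightharpoonup> product_map p q \<tau>" if "\<sigma> \<in> \<Gamma>" "\<tau> \<in> \<Gamma>" for \<sigma> \<tau>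
  proof -
    let ?P = "\<sigma> \<rightharpoonup> p \<tau>" and ?Q = "\<sigma> \<rightharpoonup> q \<tau>"
    have "product_map p q (\<sigma> \<star> \<tau>) \<cdot> \<partial> (product_twist p \<epsilon> q \<eta> (\<sigma>, \<tau>))
        = (p (\<sigma> \<star> \<tau>) \<cdot> \<partial> (\<epsilon> (\<sigma>, \<tau>))) \<cdot> (q (\<sigma> \<star> \<tau>) \<cdot> \<partial> (\<eta> (\<sigma>, \<tau>)))
          \<cdot> (inv0 ?Q \<cdot> \<partial> \<lbrace>q \<sigma>, ?P\<rbrace> \<cdot> ?Q)"
      using that twisted_mapD(3,4)[OF z] twisted_mapD(3,4)[OF w] by (simp add: bd_ract word_simps)
    also have "\<dots> = (p \<sigma> \<cdot> ?P) \<cdot> (q \<sigma> \<cdot> ?Q) \<cdot> (inv0 ?Q \<cdot> \<partial> \<lbrace>q \<sigma>, ?P\<rbrace> \<cdot> ?Q)"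
      using that twisted_mapD[OF z] twisted_mapD[OF w] by simp
    also have "\<dots> = product_map p q \<sigma> \<cdot> \<sigma> \<rightharpoonup> product_map p q \<tau>"
      using that twisted_mapD(3,4)[OF z] twisted_mapD(3,4)[OF w] by (simp add: bd_braid word_simps)
    finally show ?thesis .
  qed
  then show ?thesis
    using twisted_mapD(3-6)[OF z] twisted_mapD(3-6)[OF w]
    by (auto simp: twisted_map_def product_map_def product_twist_def)
qed

text \<open>Besides closure under products, this gives the cocycle identity for inverses: it can
  be cancelled from the product as well as transferred to it.\<close>

lemma product_cocycle_at:
  assumes z: "twisted_map p \<epsilon>" and w: "twisted_map q \<eta>"
    and "cocycle_at q \<eta> \<sigma> \<tau> \<upsilon>" and G: "\<sigma> \<in> \<Gamma>" "\<tau> \<in> \<Gamma>" "\<upsilon> \<in> \<Gamma>"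
  shows "cocycle_at (product_map p q) (product_twist p \<epsilon> q \<eta>) \<sigma> \<tau> \<upsilon> \<longleftrightarrow> cocycle_at p \<epsilon> \<sigma> \<tau> \<upsilon>"
proof -
  let ?E = "product_twist p \<epsilon> q \<eta>"
  let ?K = "((\<lbrace>q \<sigma>, \<sigma> \<rightharpoonup> p \<tau> \<cdot> \<sigma> \<rightharpoonup> \<tau> \<rightharpoonup> p \<upsilon>\<rbrace> \<triangleleft> \<sigma> \<rightharpoonup> q \<tau>)
    \<bullet> \<lbrace>\<sigma> \<rightharpoonup> q \<tau>, \<sigma> \<rightharpoonup> \<tau> \<rightharpoonup> p \<upsilon>\<rbrace>) \<triangleleft> \<sigma> \<rightharpoonup> \<tau> \<rightharpoonup> q \<upsilon>"
  let ?l = "\<epsilon> (\<sigma>, \<tau> \<star> \<upsilon>) \<bullet> \<sigma> \<rightharpoondown> \<epsilon> (\<tau>, \<upsilon>)"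
  let ?r = "\<epsilon> (\<sigma> \<star> \<tau>, \<upsilon>) \<bullet> (\<epsilon> (\<sigma>, \<tau>) \<triangleleft> \<sigma> \<rightharpoonup> \<tau> \<rightharpoonup> p \<upsilon>)"
  let ?l' = "\<eta> (\<sigma>, \<tau> \<star> \<upsilon>) \<bullet> \<sigma> \<rightharpoondown> \<eta> (\<tau>, \<upsilon>)"
  let ?r' = "\<eta> (\<sigma> \<star> \<tau>, \<upsilon>) \<bullet> (\<eta> (\<sigma>, \<tau>) \<triangleleft> \<sigma> \<rightharpoonup> \<tau> \<rightharpoonup> q \<upsilon>)"
  let ?w = "q (\<sigma> \<star> \<tau> \<star> \<upsilon>)"
  note zD = twisted_mapD(3,4)[OF z] and wD = twisted_mapD(3,4)[OF w]
  have bd\<sigma>: "\<sigma> \<rightharpoonup> p (\<tau> \<star> \<upsilon>) \<cdot> \<partial> (\<sigma> \<rightharpoondown> \<epsilon> (\<tau>, \<upsilon>)) = \<sigma> \<rightharpoonup> p \<tau> \<cdot> \<sigma> \<rightharpoonup> \<tau> \<rightharpoonup> p \<upsilon>"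
    "\<sigma> \<rightharpoonup> q (\<tau> \<star> \<upsilon>) \<cdot> \<partial> (\<sigma> \<rightharpoondown> \<eta> (\<tau>, \<upsilon>)) = \<sigma> \<rightharpoonup> q \<tau> \<cdot> \<sigma> \<rightharpoonup> \<tau> \<rightharpoonup> q \<upsilon>"
    using G zD wD twisted_mapD(7)[OF z, of \<tau> \<upsilon>] twisted_mapD(7)[OF w, of \<tau> \<upsilon>]
    by (simp_all flip: lact0_simps(2))
  have lr: "?l' = ?r'"
    using assms by (simp add: cocycle_at_def)
  have L: "?E (\<sigma>, \<tau> \<star> \<upsilon>) \<bullet> \<sigma> \<rightharpoondown> ?E (\<tau>, \<upsilon>) = (?l \<triangleleft> ?w) \<bullet> ?l' \<bullet> ?K"
    using product_cocycle_left[of "q \<sigma>" "\<sigma> \<rightharpoonup> p (\<tau> \<star> \<upsilon>)" "\<sigma> \<rightharpoonup> q (\<tau> \<star> \<upsilon>)" ?w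
        "\<sigma> \<rightharpoonup> p \<tau>" "\<sigma> \<rightharpoonup> \<tau> \<rightharpoonup> p \<upsilon>" "\<sigma> \<rightharpoonup> q \<tau>" "\<sigma> \<rightharpoonup> \<tau> \<rightharpoonup> q \<upsilon>"
        "\<sigma> \<rightharpoondown> \<epsilon> (\<tau>, \<upsilon>)" "\<sigma> \<rightharpoondown> \<eta> (\<tau>, \<upsilon>)" "\<epsilon> (\<sigma>, \<tau> \<star> \<upsilon>)" "\<eta> (\<sigma>, \<tau> \<star> \<upsilon>)"]
      G zD wD bd\<sigma> twisted_mapD(7)[OF w, of \<sigma> "\<tau> \<star> \<upsilon>"]
    by (simp add: Gam.m_assoc)
  have R: "?E (\<sigma> \<star> \<tau>, \<upsilon>) \<bullet> (?E (\<sigma>, \<tau>) \<triangleleft> \<sigma> \<rightharpoonup> \<tau> \<rightharpoonup> product_map p q \<upsilon>) = (?r \<triangleleft> ?w) \<bullet> ?r' \<bullet> ?K"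
    using product_cocycle_right[of "q \<sigma>" "\<sigma> \<rightharpoonup> p \<tau>" "\<sigma> \<rightharpoonup> q \<tau>" "q (\<sigma> \<star> \<tau>)"
        "\<sigma> \<rightharpoonup> \<tau> \<rightharpoonup> p \<upsilon>" "\<sigma> \<rightharpoonup> \<tau> \<rightharpoonup> q \<upsilon>" ?w
        "\<epsilon> (\<sigma>, \<tau>)" "\<eta> (\<sigma>, \<tau>)" "\<epsilon> (\<sigma> \<star> \<tau>, \<upsilon>)" "\<eta> (\<sigma> \<star> \<tau>, \<upsilon>)"]
      G zD wD twisted_mapD(7)[OF w, of \<sigma> \<tau>] twisted_mapD(7)[OF w, of "\<sigma> \<star> \<tau>" \<upsilon>]
    by simp
  have "?l \<in> Ar" "?r \<in> Ar" "?r' \<in> Ar" "?w \<in> Ob" "?K \<in> Ar"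
    using G zD wD by simp_all
  then show ?thesis
    unfolding cocycle_at_def L R lr by (rule ract_mult_cancel)
qed

lemma Z1_one_closed: "\<one>\<^bsub>Z1 X\<^esub> \<in> Z1_set X"
  by (simp add: Z1_simps Z1_set_iff twisted_map_def cocycle_at_def)

text \<open>The formula for the twist of the inverse comes from solving
  \<open>\<epsilon>(\<sigma>, \<tau>)\<^bsup>q(\<sigma>\<tau>)\<^esup> \<eta>(\<sigma>, \<tau>) {q(\<sigma>), \<^sup>\<sigma>q(\<tau>)\<inverse>}\<^bsup>\<^sup>\<sigma>q(\<tau>)\<^esup> = \<one>\<close> for \<open>\<epsilon>\<close>, where the last factor
  is the inverse of \<open>{q(\<sigma>), \<^sup>\<sigma>q(\<tau>)}\<close>.\<close>

lemma Z1_left_inverse: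
  assumes "z \<in> Z1_set X"
  shows "\<exists>w\<in>Z1_set X. w \<otimes>\<^bsub>Z1 X\<^esub> z = \<one>\<^bsub>Z1 X\<^esub>"
proof -
  obtain q \<eta> where z: "z = (q, \<eta>)" and tw: "twisted_map q \<eta>"
    and coc: "\<And>\<sigma> \<tau> \<upsilon>. \<lbrakk>\<sigma> \<in> \<Gamma>; \<tau> \<in> \<Gamma>; \<upsilon> \<in> \<Gamma>\<rbrakk> \<Longrightarrow> cocycle_at q \<eta> \<sigma> \<tau> \<upsilon>"
    using assms by (blast elim: Z1_set_cases)
  note qD = twisted_mapD(3-6)[OF tw]
  define p where "p = (\<lambda>\<sigma>\<in>\<Gamma>. inv0 (q \<sigma>))"
  define \<epsilon> where "\<epsilon> = (\<lambda>(\<sigma>, \<tau>)\<in>\<Gamma> \<times> \<Gamma>.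
    (\<lbrace>q \<sigma>, \<sigma> \<rightharpoonup> q \<tau>\<rbrace> \<bullet> inv1 (\<eta> (\<sigma>, \<tau>))) \<triangleleft> inv0 (q (\<sigma> \<star> \<tau>)))"
  have "p (\<sigma> \<star> \<tau>) \<cdot> \<partial> (\<epsilon> (\<sigma>, \<tau>)) = p \<sigma> \<cdot> \<sigma> \<rightharpoonup> p \<tau>" if G: "\<sigma> \<in> \<Gamma>" "\<tau> \<in> \<Gamma>" for \<sigma> \<tau>
  proof -
    have "\<partial> (\<eta> (\<sigma>, \<tau>)) = inv0 (q (\<sigma> \<star> \<tau>)) \<cdot> (q \<sigma> \<cdot> \<sigma> \<rightharpoonup> q \<tau>)"
      using G qD by (simp flip: twisted_mapD(7)[OF tw])
    then show ?thesis
      using G qD by (simp add: p_def \<epsilon>_def bd_ract bd_braid word_simps)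
  qed
  then have tp: "twisted_map p \<epsilon>"
    using qD by (auto simp: twisted_map_def p_def \<epsilon>_def)
  have twist: "product_twist p \<epsilon> q \<eta> (\<sigma>, \<tau>) = \<one>\<^sub>1" if G: "\<sigma> \<in> \<Gamma>" "\<tau> \<in> \<Gamma>" for \<sigma> \<tau>
    using G qD by (simp add: p_def \<epsilon>_def word_simps braid_inv_right)
  have one: "(p, \<epsilon>) \<otimes>\<^bsub>Z1 X\<^esub> z = \<one>\<^bsub>Z1 X\<^esub>"
    using qD twist
    by (auto simp: z Z1_simps product_map_def p_def fun_eq_iff intro!: restrict_ext)
      (auto simp: product_twist_def)
  have "cocycle_at p \<epsilon> \<sigma> \<tau> \<upsilon>" if "\<sigma> \<in> \<Gamma>" "\<tau> \<in> \<Gamma>" "\<upsilon> \<in> \<Gamma>" for \<sigma> \<tau> \<upsilon>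
    using product_cocycle_at[OF tp tw coc, of \<sigma> \<tau> \<upsilon>] that Z1_one_closed one
    by (simp add: z Z1_simps Z1_set_iff)
  then have "(p, \<epsilon>) \<in> Z1_set X"
    using tp by (simp add: Z1_set_iff)
  with one show ?thesis by blast
qed

lemma Z1_mult_closed:
  assumes "z \<in> Z1_set X" "w \<in> Z1_set X"
  shows "z \<otimes>\<^bsub>Z1 X\<^esub> w \<in> Z1_set X"
  using assms
  by (auto elim!: Z1_set_cases simp: Z1_simps Z1_set_iff twisted_map_product product_cocycle_at)

lemma Z1_assoc:
  assumes "z \<in> Z1_set X" "w \<in> Z1_set X" "v \<in> Z1_set X"
  shows "z \<otimes>\<^bsub>Z1 X\<^esub> w \<otimes>\<^bsub>Z1 X\<^esub> v = z \<otimes>\<^bsub>Z1 X\<^esub> (w \<otimes>\<^bsub>Z1 X\<^esub> v)"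
proof -
  obtain p \<epsilon> q \<eta> r \<kappa> where E: "z = (p, \<epsilon>)" "w = (q, \<eta>)" "v = (r, \<kappa>)"
    and T: "twisted_map p \<epsilon>" "twisted_map q \<eta>" "twisted_map r \<kappa>"
    using assms by (metis Z1_set_cases)
  note D = twisted_mapD(3,4)[OF T(1)] twisted_mapD(3,4)[OF T(2)] twisted_mapD(3,4)[OF T(3)]
  have "product_map (product_map p q) r = product_map p (product_map q r)"
    using D by (auto simp: product_map_def word_simps intro!: restrict_ext)
  moreover have "product_twist (product_map p q) (product_twist p \<epsilon> q \<eta>) r \<kappa> (\<sigma>, \<tau>)
      = product_twist p \<epsilon> (product_map q r) (product_twist q \<eta> r \<kappa>) (\<sigma>, \<tau>)"
    if "\<sigma> \<in> \<Gamma>" "\<tau> \<in> \<Gamma>" for \<sigma> \<tau>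
    using that D twisted_mapD(7)[OF T(3), of \<sigma> \<tau>]
      product_assoc[of "q (\<sigma> \<star> \<tau>)" "r (\<sigma> \<star> \<tau>)" "\<sigma> \<rightharpoonup> p \<tau>" "q \<sigma>" "\<sigma> \<rightharpoonup> q \<tau>" "r \<sigma>" "\<sigma> \<rightharpoonup> r \<tau>"
        "\<epsilon> (\<sigma>, \<tau>)" "\<eta> (\<sigma>, \<tau>)" "\<kappa> (\<sigma>, \<tau>)"]
    by simp
  then have "product_twist (product_map p q) (product_twist p \<epsilon> q \<eta>) r \<kappa>
      = product_twist p \<epsilon> (product_map q r) (product_twist q \<eta> r \<kappa>)"
    by (auto simp: product_twist_def intro!: restrict_ext)
  ultimately show ?thesis
    by (simp add: E Z1_simps)
qed

sublocale Z1: group "Z1 X"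
proof (rule groupI, goal_cases)
  case (4 z)
  then obtain p \<epsilon> where z: "z = (p, \<epsilon>)" "twisted_map p \<epsilon>"
    by (auto simp: Z1_simps elim: Z1_set_cases)
  note D = twisted_mapD(1-4)[OF z(2)]
  have "product_map (\<lambda>\<sigma>\<in>\<Gamma>. \<one>\<^sub>0) p = p"
    by (rule extensionalityI[where A = \<Gamma>]) (use D in \<open>auto simp: product_map_def\<close>)
  moreover have "product_twist (\<lambda>\<sigma>\<in>\<Gamma>. \<one>\<^sub>0) (\<lambda>_\<in>\<Gamma> \<times> \<Gamma>. \<one>\<^sub>1) p \<epsilon> = \<epsilon>"
    by (rule extensionalityI[where A = "\<Gamma> \<times> \<Gamma>"]) (use D in \<open>auto simp: product_twist_def\<close>)
  ultimately show ?case
    by (simp add: z Z1_simps)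
qed (use Z1_mult_closed Z1_one_closed Z1_assoc Z1_left_inverse in \<open>simp_all add: Z1_simps(1)\<close>)

end

section \<open>Isomorphism of cocycles and the group \<open>H\<^sup>1\<close>\<close>

context gamma_crossed_module
begin

text \<open>The two conditions that define an isomorphism of cocycles, rearranged so that no inverses
  of arrows occur: \<open>\<theta>(\<sigma>)\<close> is an arrow \<open>q(\<sigma>) \<rightarrow> g\<inverse> \<cdot> p(\<sigma>) \<cdot> \<^sup>\<sigma>g\<close>, and the two arrows from
  \<open>q(\<sigma>\<tau>)\<close> to \<open>g\<inverse> \<cdot> p(\<sigma>) \<cdot> \<^sup>\<sigma>p(\<tau>) \<cdot> \<^sup>\<sigma>\<^sup>\<tau>g\<close> agree.\<close>

definition iso_via where
  "iso_via p \<epsilon> q \<eta> g \<theta> \<longleftrightarrow> g \<in> Ob \<and> (\<forall>\<sigma>\<in>\<Gamma>. \<theta> \<sigma> \<in> Ar)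
    \<and> (\<forall>\<sigma>\<in>\<Gamma>. q \<sigma> \<cdot> \<partial> (\<theta> \<sigma>) = inv0 g \<cdot> p \<sigma> \<cdot> \<sigma> \<rightharpoonup> g)
    \<and> (\<forall>\<sigma>\<in>\<Gamma>. \<forall>\<tau>\<in>\<Gamma>. \<eta> (\<sigma>, \<tau>) \<bullet> (\<theta> \<sigma> \<triangleleft> \<sigma> \<rightharpoonup> q \<tau>) \<bullet> \<sigma> \<rightharpoondown> \<theta> \<tau>
        = \<theta> (\<sigma> \<star> \<tau>) \<bullet> (\<epsilon> (\<sigma>, \<tau>) \<triangleleft> \<sigma> \<rightharpoonup> \<tau> \<rightharpoonup> g))"

text \<open>Restricting \<open>\<theta>\<close> to \<open>\<Gamma>\<close> gives an element of \<open>C\<^sup>0\<close>, because the second condition at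
  \<open>(\<one>, \<one>)\<close> forces \<open>\<theta>(\<one>) = \<one>\<close>.\<close>

lemma Z1_iso_iff:
  "((p, \<epsilon>), (q, \<eta>)) \<in> Z1_iso X
    \<longleftrightarrow> (p, \<epsilon>) \<in> Z1_set X \<and> (q, \<eta>) \<in> Z1_set X \<and> (\<exists>g \<theta>. iso_via p \<epsilon> q \<eta> g \<theta>)"
proof (cases "(p, \<epsilon>) \<in> Z1_set X \<and> (q, \<eta>) \<in> Z1_set X")
  case True
  then have T: "twisted_map p \<epsilon>" "twisted_map q \<eta>"
    by (simp_all add: Z1_set_iff)
  note D = twisted_mapD(3-6)[OF T(1)] twisted_mapD(3-6)[OF T(2)]
  have bd_iff: "q \<sigma> = inv0 g \<cdot> p \<sigma> \<cdot> \<sigma> \<rightharpoonup> g \<cdot> inv0 (\<partial> (\<theta> \<sigma>))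
      \<longleftrightarrow> q \<sigma> \<cdot> \<partial> (\<theta> \<sigma>) = inv0 g \<cdot> p \<sigma> \<cdot> \<sigma> \<rightharpoonup> g"
    if "g \<in> Ob" "\<theta> \<sigma> \<in> Ar" "\<sigma> \<in> \<Gamma>" for g \<theta> \<sigma>
    using that D K0.inv_solve_right[of "q \<sigma>" "inv0 g \<cdot> p \<sigma> \<cdot> \<sigma> \<rightharpoonup> g" "\<partial> (\<theta> \<sigma>)"] by auto
  have twist_iff: "\<eta> (\<sigma>, \<tau>) = \<theta> (\<sigma> \<star> \<tau>) \<bullet> (\<epsilon> (\<sigma>, \<tau>) \<triangleleft> (\<sigma> \<star> \<tau>) \<rightharpoonup> g)
        \<bullet> inv1 (\<sigma> \<rightharpoondown> \<theta> \<tau>) \<bullet> (inv1 (\<theta> \<sigma>) \<triangleleft> \<sigma> \<rightharpoonup> q \<tau>)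
      \<longleftrightarrow> \<eta> (\<sigma>, \<tau>) \<bullet> (\<theta> \<sigma> \<triangleleft> \<sigma> \<rightharpoonup> q \<tau>) \<bullet> \<sigma> \<rightharpoondown> \<theta> \<tau>
        = \<theta> (\<sigma> \<star> \<tau>) \<bullet> (\<epsilon> (\<sigma>, \<tau>) \<triangleleft> \<sigma> \<rightharpoonup> \<tau> \<rightharpoonup> g)" (is "?l \<longleftrightarrow> ?r")
    if "g \<in> Ob" "\<forall>\<sigma>\<in>\<Gamma>. \<theta> \<sigma> \<in> Ar" "\<sigma> \<in> \<Gamma>" "\<tau> \<in> \<Gamma>" for g \<theta> \<sigma> \<tau>
  proof -
    let ?a = "\<theta> (\<sigma> \<star> \<tau>) \<bullet> (\<epsilon> (\<sigma>, \<tau>) \<triangleleft> \<sigma> \<rightharpoonup> \<tau> \<rightharpoonup> g)"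
    have "?l \<longleftrightarrow> \<eta> (\<sigma>, \<tau>) = ?a \<bullet> inv1 (\<sigma> \<rightharpoondown> \<theta> \<tau>) \<bullet> inv1 (\<theta> \<sigma> \<triangleleft> \<sigma> \<rightharpoonup> q \<tau>)"
      using that D by (simp add: inv_ract)
    also have "\<dots> \<longleftrightarrow> ?a \<bullet> inv1 (\<sigma> \<rightharpoondown> \<theta> \<tau>) = \<eta> (\<sigma>, \<tau>) \<bullet> (\<theta> \<sigma> \<triangleleft> \<sigma> \<rightharpoonup> q \<tau>)"
      using that D by (intro K1.inv_solve_right) simp_all
    also have "\<dots> \<longleftrightarrow> \<eta> (\<sigma>, \<tau>) \<bullet> (\<theta> \<sigma> \<triangleleft> \<sigma> \<rightharpoonup> q \<tau>) = ?a \<bullet> inv1 (\<sigma> \<rightharpoondown> \<theta> \<tau>)"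
      by auto
    also have "\<dots> \<longleftrightarrow> ?a = \<eta> (\<sigma>, \<tau>) \<bullet> (\<theta> \<sigma> \<triangleleft> \<sigma> \<rightharpoonup> q \<tau>) \<bullet> \<sigma> \<rightharpoondown> \<theta> \<tau>"
      using that D by (intro K1.inv_solve_right) simp_all
    finally show ?thesis by auto
  qed
  show ?thesis
  proof
    assume "((p, \<epsilon>), (q, \<eta>)) \<in> Z1_iso X"
    then obtain g \<theta> where "(g, \<theta>) \<in> C0 X"
      and "\<forall>\<sigma>\<in>\<Gamma>. q \<sigma> = inv0 g \<cdot> p \<sigma> \<cdot> \<sigma> \<rightharpoonup> g \<cdot> inv0 (\<partial> (\<theta> \<sigma>))"
      and "\<forall>\<sigma>\<in>\<Gamma>. \<forall>\<tau>\<in>\<Gamma>. \<eta> (\<sigma>, \<tau>) = \<theta> (\<sigma> \<star> \<tau>) \<bullet> (\<epsilon> (\<sigma>, \<tau>) \<triangleleft> (\<sigma> \<star> \<tau>) \<rightharpoonup> g)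
        \<bullet> inv1 (\<sigma> \<rightharpoondown> \<theta> \<tau>) \<bullet> (inv1 (\<theta> \<sigma>) \<triangleleft> \<sigma> \<rightharpoonup> q \<tau>)"
      unfolding Z1_iso_def by blast
    moreover from this(1) have C: "g \<in> Ob" "\<forall>\<sigma>\<in>\<Gamma>. \<theta> \<sigma> \<in> Ar"
      by (auto simp: C0_def)
    ultimately have "iso_via p \<epsilon> q \<eta> g \<theta>"
      unfolding iso_via_def by (metis bd_iff twist_iff)
    with True show "(p, \<epsilon>) \<in> Z1_set X \<and> (q, \<eta>) \<in> Z1_set X \<and> (\<exists>g \<theta>. iso_via p \<epsilon> q \<eta> g \<theta>)"
      by blast
  next
    assume "(p, \<epsilon>) \<in> Z1_set X \<and> (q, \<eta>) \<in> Z1_set X \<and> (\<exists>g \<theta>. iso_via p \<epsilon> q \<eta> g \<theta>)"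
    then obtain g \<phi> where iso: "iso_via p \<epsilon> q \<eta> g \<phi>" by blast
    define \<theta> where "\<theta> = restrict \<phi> \<Gamma>"
    have iso\<theta>: "iso_via p \<epsilon> q \<eta> g \<theta>"
      using iso by (simp add: iso_via_def \<theta>_def)
    then have C: "g \<in> Ob" "\<forall>\<sigma>\<in>\<Gamma>. \<theta> \<sigma> \<in> Ar"
      by (auto simp: iso_via_def)
    have "\<eta> (\<one>\<^sub>\<Gamma>, \<one>\<^sub>\<Gamma>) \<bullet> (\<theta> \<one>\<^sub>\<Gamma> \<triangleleft> \<one>\<^sub>\<Gamma> \<rightharpoonup> q \<one>\<^sub>\<Gamma>) \<bullet> \<one>\<^sub>\<Gamma> \<rightharpoondown> \<theta> \<one>\<^sub>\<Gamma>
        = \<theta> (\<one>\<^sub>\<Gamma> \<star> \<one>\<^sub>\<Gamma>) \<bullet> (\<epsilon> (\<one>\<^sub>\<Gamma>, \<one>\<^sub>\<Gamma>) \<triangleleft> \<one>\<^sub>\<Gamma> \<rightharpoonup> \<one>\<^sub>\<Gamma> \<rightharpoonup> g)"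
      using iso\<theta> unfolding iso_via_def by blast
    then have "\<theta> \<one>\<^sub>\<Gamma> = \<one>\<^sub>1"
      using C D by simp
    then have "(g, \<theta>) \<in> C0 X"
      using C by (auto simp: C0_def \<theta>_def)
    moreover have "\<forall>\<sigma>\<in>\<Gamma>. q \<sigma> = inv0 g \<cdot> p \<sigma> \<cdot> \<sigma> \<rightharpoonup> g \<cdot> inv0 (\<partial> (\<theta> \<sigma>))"
      using iso\<theta> C unfolding iso_via_def by (metis bd_iff)
    moreover have "\<forall>\<sigma>\<in>\<Gamma>. \<forall>\<tau>\<in>\<Gamma>. \<eta> (\<sigma>, \<tau>) = \<theta> (\<sigma> \<star> \<tau>) \<bullet> (\<epsilon> (\<sigma>, \<tau>) \<triangleleft> (\<sigma> \<star> \<tau>) \<rightharpoonup> g)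
        \<bullet> inv1 (\<sigma> \<rightharpoondown> \<theta> \<tau>) \<bullet> (inv1 (\<theta> \<sigma>) \<triangleleft> \<sigma> \<rightharpoonup> q \<tau>)"
      using iso\<theta> C unfolding iso_via_def by (metis twist_iff)
    ultimately show "((p, \<epsilon>), (q, \<eta>)) \<in> Z1_iso X"
      using True unfolding Z1_iso_def by blast
  qed
next
  case False
  then show ?thesis
    unfolding Z1_iso_def by blast
qed

lemma iso_viaD:
  assumes "iso_via p \<epsilon> q \<eta> g \<theta>"
  shows "g \<in> Ob" and "\<sigma> \<in> \<Gamma> \<Longrightarrow> \<theta> \<sigma> \<in> Ar"
    and "\<sigma> \<in> \<Gamma> \<Longrightarrow> q \<sigma> \<cdot> \<partial> (\<theta> \<sigma>) = inv0 g \<cdot> p \<sigma> \<cdot> \<sigma> \<rightharpoonup> g"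
    and "\<lbrakk>\<sigma> \<in> \<Gamma>; \<tau> \<in> \<Gamma>\<rbrakk> \<Longrightarrow> \<eta> (\<sigma>, \<tau>) \<bullet> (\<theta> \<sigma> \<triangleleft> \<sigma> \<rightharpoonup> q \<tau>) \<bullet> \<sigma> \<rightharpoondown> \<theta> \<tau>
        = \<theta> (\<sigma> \<star> \<tau>) \<bullet> (\<epsilon> (\<sigma>, \<tau>) \<triangleleft> \<sigma> \<rightharpoonup> \<tau> \<rightharpoonup> g)"
  using assms by (simp_all add: iso_via_def)

lemma iso_via_bd_lact:
  assumes "iso_via p \<epsilon> q \<eta> g \<theta>" "\<sigma> \<in> \<Gamma>" "\<tau> \<in> \<Gamma>" "p \<tau> \<in> Ob" "q \<tau> \<in> Ob"
  shows "\<sigma> \<rightharpoonup> q \<tau> \<cdot> \<partial> (\<sigma> \<rightharpoondown> \<theta> \<tau>) = inv0 (\<sigma> \<rightharpoonup> g) \<cdot> \<sigma> \<rightharpoonup> p \<tau> \<cdot> \<sigma> \<rightharpoonup> \<tau> \<rightharpoonup> g"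
proof -
  have "\<sigma> \<rightharpoonup> (q \<tau> \<cdot> \<partial> (\<theta> \<tau>)) = \<sigma> \<rightharpoonup> (inv0 g \<cdot> p \<tau> \<cdot> \<tau> \<rightharpoonup> g)"
    using iso_viaD(3)[OF assms(1,3)] by simp
  then show ?thesis
    using assms iso_viaD(1,2)[OF assms(1)] by simp
qed

lemma iso_via_refl:
  assumes "twisted_map p \<epsilon>"
  shows "iso_via p \<epsilon> p \<epsilon> \<one>\<^sub>0 (\<lambda>_. \<one>\<^sub>1)"
  using twisted_mapD(3,4)[OF assms] by (simp add: iso_via_def)

text \<open>Multiplying \<open>\<theta>(\<sigma>)\<inverse> : g\<inverse> \<cdot> p(\<sigma>) \<cdot> \<^sup>\<sigma>g \<rightarrow> q(\<sigma>)\<close> on both sides by the inverses of the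
  outer factors turns it into an arrow \<open>p(\<sigma>) \<rightarrow> g \<cdot> q(\<sigma>) \<cdot> \<^sup>\<sigma>g\<inverse>\<close>.\<close>

lemma iso_via_sym:
  assumes T: "twisted_map p \<epsilon>" "twisted_map q \<eta>" and iso: "iso_via p \<epsilon> q \<eta> g \<theta>"
  shows "iso_via q \<eta> p \<epsilon> (inv0 g) (\<lambda>\<sigma>. inv1 (\<theta> \<sigma>) \<triangleleft> inv0 (\<sigma> \<rightharpoonup> g))"
proof -
  note D = twisted_mapD(3,4)[OF T(1)] twisted_mapD(3,4)[OF T(2)] iso_viaD(1,2)[OF iso]
  have bd: "p \<sigma> \<cdot> \<partial> (inv1 (\<theta> \<sigma>) \<triangleleft> inv0 (\<sigma> \<rightharpoonup> g)) = g \<cdot> q \<sigma> \<cdot> inv0 (\<sigma> \<rightharpoonup> g)"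
    if "\<sigma> \<in> \<Gamma>" for \<sigma>
  proof -
    have "p \<sigma> \<cdot> \<sigma> \<rightharpoonup> g = g \<cdot> (q \<sigma> \<cdot> \<partial> (\<theta> \<sigma>))"
      using that D iso_viaD(3)[OF iso that] by (simp add: word_simps)
    then have "p \<sigma> = g \<cdot> (q \<sigma> \<cdot> \<partial> (\<theta> \<sigma>)) \<cdot> inv0 (\<sigma> \<rightharpoonup> g)"
      using that D by (subst K0.inv_solve_right) simp_all
    then show ?thesis
      using that D by (simp add: bd_ract word_simps)
  qed
  have twist: "\<epsilon> (\<sigma>, \<tau>) \<bullet> ((inv1 (\<theta> \<sigma>) \<triangleleft> inv0 (\<sigma> \<rightharpoonup> g)) \<triangleleft> \<sigma> \<rightharpoonup> p \<tau>)
        \<bullet> \<sigma> \<rightharpoondown> (inv1 (\<theta> \<tau>) \<triangleleft> inv0 (\<tau> \<rightharpoonup> g))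
      = (inv1 (\<theta> (\<sigma> \<star> \<tau>)) \<triangleleft> inv0 ((\<sigma> \<star> \<tau>) \<rightharpoonup> g)) \<bullet> (\<eta> (\<sigma>, \<tau>) \<triangleleft> \<sigma> \<rightharpoonup> \<tau> \<rightharpoonup> inv0 g)"
    if "\<sigma> \<in> \<Gamma>" "\<tau> \<in> \<Gamma>" for \<sigma> \<tau>
  proof -
    let ?k = "\<sigma> \<rightharpoonup> \<tau> \<rightharpoonup> g" and ?s = "\<sigma> \<rightharpoondown> \<theta> \<tau>" and ?t = "\<theta> \<sigma> \<triangleleft> \<sigma> \<rightharpoonup> q \<tau>"
    have bds: "(inv0 (\<sigma> \<rightharpoonup> g) \<cdot> \<sigma> \<rightharpoonup> p \<tau> \<cdot> ?k) \<cdot> \<partial> (inv1 ?s) = \<sigma> \<rightharpoonup> q \<tau>"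
      using that D by (subst iso_via_bd_lact[OF iso, symmetric]) (simp_all add: K0.m_assoc)
    have "\<epsilon> (\<sigma>, \<tau>) \<triangleleft> ?k = inv1 (\<theta> (\<sigma> \<star> \<tau>)) \<bullet> (\<theta> (\<sigma> \<star> \<tau>) \<bullet> (\<epsilon> (\<sigma>, \<tau>) \<triangleleft> ?k))"
      using that D by simp
    also have "\<dots> = inv1 (\<theta> (\<sigma> \<star> \<tau>)) \<bullet> (\<eta> (\<sigma>, \<tau>) \<bullet> ?t \<bullet> ?s)"
      using iso_viaD(4)[OF iso that] by simp
    finally have "(\<epsilon> (\<sigma>, \<tau>) \<triangleleft> ?k) \<bullet> inv1 ?s \<bullet> inv1 ?t = inv1 (\<theta> (\<sigma> \<star> \<tau>)) \<bullet> \<eta> (\<sigma>, \<tau>)"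
      using that D by (simp add: K1.m_assoc)
    moreover have "inv1 ?s \<bullet> inv1 ?t
        = (inv1 (\<theta> \<sigma>) \<triangleleft> (inv0 (\<sigma> \<rightharpoonup> g) \<cdot> \<sigma> \<rightharpoonup> p \<tau> \<cdot> ?k)) \<bullet> inv1 ?s"
      using that D slide[OF _ _ _ bds, of "inv1 (\<theta> \<sigma>)"] by (simp add: inv_ract)
    ultimately have "(\<epsilon> (\<sigma>, \<tau>) \<triangleleft> ?k)
        \<bullet> ((inv1 (\<theta> \<sigma>) \<triangleleft> (inv0 (\<sigma> \<rightharpoonup> g) \<cdot> \<sigma> \<rightharpoonup> p \<tau> \<cdot> ?k)) \<bullet> inv1 ?s)
        = inv1 (\<theta> (\<sigma> \<star> \<tau>)) \<bullet> \<eta> (\<sigma>, \<tau>)"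
      using that D by (simp add: K1.m_assoc)
    \<comment> \<open>The identity above is the desired one acted on by \<open>\<^sup>\<sigma>\<^sup>\<tau>g\<close>.\<close>
    from arg_cong[OF this, of "\<lambda>\<alpha>. \<alpha> \<triangleleft> inv0 ?k"] show ?thesis
      using that D by (simp add: word_simps)
  qed
  show ?thesis
    using D bd twist by (simp add: iso_via_def)
qed

text \<open>The composite arrow is
  \<open>r(\<sigma>) \<rightarrow> h\<inverse> \<cdot> q(\<sigma>) \<cdot> \<^sup>\<sigma>h \<rightarrow> h\<inverse> \<cdot> g\<inverse> \<cdot> p(\<sigma>) \<cdot> \<^sup>\<sigma>g \<cdot> \<^sup>\<sigma>h\<close>.\<close>

lemma iso_via_trans:
  assumes T: "twisted_map p \<epsilon>" "twisted_map q \<eta>" "twisted_map r \<kappa>"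
    and iso: "iso_via p \<epsilon> q \<eta> g \<theta>" "iso_via q \<eta> r \<kappa> h \<phi>"
  shows "iso_via p \<epsilon> r \<kappa> (g \<cdot> h) (\<lambda>\<sigma>. \<phi> \<sigma> \<bullet> (\<theta> \<sigma> \<triangleleft> \<sigma> \<rightharpoonup> h))"
proof -
  note D = twisted_mapD(3,4)[OF T(1)] twisted_mapD(3,4)[OF T(2)] twisted_mapD(3,4)[OF T(3)]
    iso_viaD(1,2)[OF iso(1)] iso_viaD(1,2)[OF iso(2)]
  have bd: "r \<sigma> \<cdot> \<partial> (\<phi> \<sigma> \<bullet> (\<theta> \<sigma> \<triangleleft> \<sigma> \<rightharpoonup> h)) = inv0 (g \<cdot> h) \<cdot> p \<sigma> \<cdot> \<sigma> \<rightharpoonup> (g \<cdot> h)"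
    if "\<sigma> \<in> \<Gamma>" for \<sigma>
  proof -
    have "r \<sigma> \<cdot> \<partial> (\<phi> \<sigma> \<bullet> (\<theta> \<sigma> \<triangleleft> \<sigma> \<rightharpoonup> h))
        = (r \<sigma> \<cdot> \<partial> (\<phi> \<sigma>)) \<cdot> (inv0 (\<sigma> \<rightharpoonup> h) \<cdot> \<partial> (\<theta> \<sigma>) \<cdot> \<sigma> \<rightharpoonup> h)"
      using that D by (simp add: bd_ract word_simps)
    also have "\<dots> = inv0 h \<cdot> (q \<sigma> \<cdot> \<partial> (\<theta> \<sigma>)) \<cdot> \<sigma> \<rightharpoonup> h"
      unfolding iso_viaD(3)[OF iso(2) that] using that D by (simp add: word_simps)
    also have "\<dots> = inv0 (g \<cdot> h) \<cdot> p \<sigma> \<cdot> \<sigma> \<rightharpoonup> (g \<cdot> h)"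
      unfolding iso_viaD(3)[OF iso(1) that] using that D by (simp add: word_simps)
    finally show ?thesis .
  qed
  have twist: "\<kappa> (\<sigma>, \<tau>) \<bullet> ((\<phi> \<sigma> \<bullet> (\<theta> \<sigma> \<triangleleft> \<sigma> \<rightharpoonup> h)) \<triangleleft> \<sigma> \<rightharpoonup> r \<tau>)
        \<bullet> \<sigma> \<rightharpoondown> (\<phi> \<tau> \<bullet> (\<theta> \<tau> \<triangleleft> \<tau> \<rightharpoonup> h))
      = \<phi> (\<sigma> \<star> \<tau>) \<bullet> (\<theta> (\<sigma> \<star> \<tau>) \<triangleleft> (\<sigma> \<star> \<tau>) \<rightharpoonup> h)
        \<bullet> (\<epsilon> (\<sigma>, \<tau>) \<triangleleft> \<sigma> \<rightharpoonup> \<tau> \<rightharpoonup> (g \<cdot> h))"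
    if "\<sigma> \<in> \<Gamma>" "\<tau> \<in> \<Gamma>" for \<sigma> \<tau>
  proof -
    let ?k = "\<sigma> \<rightharpoonup> \<tau> \<rightharpoonup> h"
    have "\<kappa> (\<sigma>, \<tau>) \<bullet> ((\<phi> \<sigma> \<bullet> (\<theta> \<sigma> \<triangleleft> \<sigma> \<rightharpoonup> h)) \<triangleleft> \<sigma> \<rightharpoonup> r \<tau>) \<bullet> \<sigma> \<rightharpoondown> (\<phi> \<tau> \<bullet> (\<theta> \<tau> \<triangleleft> \<tau> \<rightharpoonup> h))
        = \<kappa> (\<sigma>, \<tau>) \<bullet> (\<phi> \<sigma> \<triangleleft> \<sigma> \<rightharpoonup> r \<tau>)
          \<bullet> ((\<theta> \<sigma> \<triangleleft> (\<sigma> \<rightharpoonup> h \<cdot> \<sigma> \<rightharpoonup> r \<tau>)) \<bullet> \<sigma> \<rightharpoondown> \<phi> \<tau>) \<bullet> ((\<sigma> \<rightharpoondown> \<theta> \<tau>) \<triangleleft> ?k)"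
      using that D by (simp add: word_simps)
    also have "(\<theta> \<sigma> \<triangleleft> (\<sigma> \<rightharpoonup> h \<cdot> \<sigma> \<rightharpoonup> r \<tau>)) \<bullet> \<sigma> \<rightharpoondown> \<phi> \<tau>
        = \<sigma> \<rightharpoondown> \<phi> \<tau> \<bullet> (\<theta> \<sigma> \<triangleleft> (\<sigma> \<rightharpoonup> q \<tau> \<cdot> ?k))"
    proof (rule slide)
      show "\<sigma> \<rightharpoonup> h \<cdot> \<sigma> \<rightharpoonup> r \<tau> \<cdot> \<partial> (\<sigma> \<rightharpoondown> \<phi> \<tau>) = \<sigma> \<rightharpoonup> q \<tau> \<cdot> ?k"
        using that D iso_via_bd_lact[OF iso(2) that] by (simp add: word_simps)
    qed (use that D in simp_all)
    also have "\<kappa> (\<sigma>, \<tau>) \<bullet> (\<phi> \<sigma> \<triangleleft> \<sigma> \<rightharpoonup> r \<tau>) \<bullet> (\<sigma> \<rightharpoondown> \<phi> \<tau> \<bullet> (\<theta> \<sigma> \<triangleleft> (\<sigma> \<rightharpoonup> q \<tau> \<cdot> ?k)))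
          \<bullet> ((\<sigma> \<rightharpoondown> \<theta> \<tau>) \<triangleleft> ?k)
        = (\<kappa> (\<sigma>, \<tau>) \<bullet> (\<phi> \<sigma> \<triangleleft> \<sigma> \<rightharpoonup> r \<tau>) \<bullet> \<sigma> \<rightharpoondown> \<phi> \<tau>)
          \<bullet> (((\<theta> \<sigma> \<triangleleft> \<sigma> \<rightharpoonup> q \<tau>) \<bullet> \<sigma> \<rightharpoondown> \<theta> \<tau>) \<triangleleft> ?k)"
      using that D by (simp add: word_simps)
    also have "\<kappa> (\<sigma>, \<tau>) \<bullet> (\<phi> \<sigma> \<triangleleft> \<sigma> \<rightharpoonup> r \<tau>) \<bullet> \<sigma> \<rightharpoondown> \<phi> \<tau> = \<phi> (\<sigma> \<star> \<tau>) \<bullet> (\<eta> (\<sigma>, \<tau>) \<triangleleft> ?k)"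
      by (rule iso_viaD(4)[OF iso(2) that])
    also have "\<phi> (\<sigma> \<star> \<tau>) \<bullet> (\<eta> (\<sigma>, \<tau>) \<triangleleft> ?k) \<bullet> (((\<theta> \<sigma> \<triangleleft> \<sigma> \<rightharpoonup> q \<tau>) \<bullet> \<sigma> \<rightharpoondown> \<theta> \<tau>) \<triangleleft> ?k)
        = \<phi> (\<sigma> \<star> \<tau>) \<bullet> ((\<eta> (\<sigma>, \<tau>) \<bullet> (\<theta> \<sigma> \<triangleleft> \<sigma> \<rightharpoonup> q \<tau>) \<bullet> \<sigma> \<rightharpoondown> \<theta> \<tau>) \<triangleleft> ?k)"
      using that D by (simp add: word_simps)
    also have "\<eta> (\<sigma>, \<tau>) \<bullet> (\<theta> \<sigma> \<triangleleft> \<sigma> \<rightharpoonup> q \<tau>) \<bullet> \<sigma> \<rightharpoondown> \<theta> \<tau>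
        = \<theta> (\<sigma> \<star> \<tau>) \<bullet> (\<epsilon> (\<sigma>, \<tau>) \<triangleleft> \<sigma> \<rightharpoonup> \<tau> \<rightharpoonup> g)"
      by (rule iso_viaD(4)[OF iso(1) that])
    finally show ?thesis
      using that D by (simp add: word_simps)
  qed
  show ?thesis
    using D bd twist by (simp add: iso_via_def)
qed

lemma Z1_iso_cases:
  assumes "(z, w) \<in> Z1_iso X"
  obtains p \<epsilon> q \<eta> g \<theta> where "z = (p, \<epsilon>)" "w = (q, \<eta>)" "twisted_map p \<epsilon>" "twisted_map q \<eta>"
    "iso_via p \<epsilon> q \<eta> g \<theta>"
  using assms by (cases z; cases w) (auto simp: Z1_iso_iff Z1_set_iff)

lemma Z1_iso_closed: "(z, w) \<in> Z1_iso X \<Longrightarrow> z \<in> Z1_set X \<and> w \<in> Z1_set X"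
  by (cases z; cases w) (simp add: Z1_iso_iff)

lemma equiv_Z1_iso: "equiv (Z1_set X) (Z1_iso X)"
proof (rule equivI)
  show "Z1_iso X \<subseteq> Z1_set X \<times> Z1_set X"
    using Z1_iso_closed by auto
  show "refl_on (Z1_set X) (Z1_iso X)"
    by (rule refl_onI) (metis Z1_iso_iff Z1_set_cases iso_via_refl)
  show "sym (Z1_iso X)"
  proof (rule symI)
    fix z w assume zw: "(z, w) \<in> Z1_iso X"
    obtain p \<epsilon> q \<eta> g \<theta> where 1: "z = (p, \<epsilon>)" "w = (q, \<eta>)" "twisted_map p \<epsilon>" "twisted_map q \<eta>"
      "iso_via p \<epsilon> q \<eta> g \<theta>"
      using zw by (rule Z1_iso_cases)
    show "(w, z) \<in> Z1_iso X"
      using iso_via_sym[OF 1(3-5)] Z1_iso_closed[OF zw] by (auto simp: 1(1,2) Z1_iso_iff)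
  qed
  show "trans (Z1_iso X)"
  proof (rule transI)
    fix z w v assume zw: "(z, w) \<in> Z1_iso X" and wv: "(w, v) \<in> Z1_iso X"
    obtain p \<epsilon> q \<eta> g \<theta> where 1: "z = (p, \<epsilon>)" "w = (q, \<eta>)" "twisted_map p \<epsilon>" "twisted_map q \<eta>"
      "iso_via p \<epsilon> q \<eta> g \<theta>"
      using zw by (rule Z1_iso_cases)
    obtain r \<kappa> h \<phi> where 2: "v = (r, \<kappa>)" "twisted_map r \<kappa>" "iso_via q \<eta> r \<kappa> h \<phi>"
      using wv 1(2) by (auto elim: Z1_iso_cases)
    show "(z, v) \<in> Z1_iso X"
      using iso_via_trans[OF 1(3,4) 2(2) 1(5) 2(3)] Z1_iso_closed[OF zw] Z1_iso_closed[OF wv]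
      by (auto simp: 1(1) 2(1) Z1_iso_iff)
  qed
qed

lemma Z1_class_eq: "(z, w) \<in> Z1_iso X \<Longrightarrow> Z1_class X z = Z1_class X w"
  unfolding Z1_class_def by (rule equiv_class_eq[OF equiv_Z1_iso])

lemma Z1_class_self: "z \<in> Z1_set X \<Longrightarrow> z \<in> Z1_class X z"
  unfolding Z1_class_def by (rule equiv_class_self[OF equiv_Z1_iso])

lemma H1_set_eq: "H1_set X = Z1_class X ` Z1_set X"
  by (auto simp: H1_set_def Z1_class_def quotient_def)

end

context braided_crossed_module
begin

text \<open>The new arrow is
  \<open>p'(\<sigma>) \<cdot> q(\<sigma>) \<rightarrow> g\<inverse> \<cdot> p(\<sigma>) \<cdot> \<^sup>\<sigma>g \<cdot> q(\<sigma>) \<rightarrow> g\<inverse> \<cdot> p(\<sigma>) \<cdot> q(\<sigma>) \<cdot> \<^sup>\<sigma>g\<close>.\<close>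

lemma iso_via_product_right:
  assumes T: "twisted_map p \<epsilon>" "twisted_map p' \<epsilon>'" "twisted_map q \<eta>"
    and iso: "iso_via p \<epsilon> p' \<epsilon>' g \<theta>"
  shows "iso_via (product_map p q) (product_twist p \<epsilon> q \<eta>)
    (product_map p' q) (product_twist p' \<epsilon>' q \<eta>) g (\<lambda>\<sigma>. (\<theta> \<sigma> \<triangleleft> q \<sigma>) \<bullet> \<lbrace>q \<sigma>, \<sigma> \<rightharpoonup> g\<rbrace>)"
proof -
  note D = twisted_mapD(3,4)[OF T(1)] twisted_mapD(3,4)[OF T(2)] twisted_mapD(3,4)[OF T(3)]
    iso_viaD(1,2)[OF iso]
  have bd: "p' \<sigma> \<cdot> q \<sigma> \<cdot> \<partial> ((\<theta> \<sigma> \<triangleleft> q \<sigma>) \<bullet> \<lbrace>q \<sigma>, \<sigma> \<rightharpoonup> g\<rbrace>) = inv0 g \<cdot> (p \<sigma> \<cdot> q \<sigma>) \<cdot> \<sigma> \<rightharpoonup> g"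
    if "\<sigma> \<in> \<Gamma>" for \<sigma>
  proof -
    have "p' \<sigma> \<cdot> q \<sigma> \<cdot> \<partial> ((\<theta> \<sigma> \<triangleleft> q \<sigma>) \<bullet> \<lbrace>q \<sigma>, \<sigma> \<rightharpoonup> g\<rbrace>)
        = (p' \<sigma> \<cdot> \<partial> (\<theta> \<sigma>)) \<cdot> (q \<sigma> \<cdot> \<partial> \<lbrace>q \<sigma>, \<sigma> \<rightharpoonup> g\<rbrace>)"
      using that D by (simp add: bd_ract word_simps)
    then show ?thesis
      unfolding iso_viaD(3)[OF iso that] using that D by (simp add: bd_braid word_simps)
  qed
  moreover have "product_twist p' \<epsilon>' q \<eta> (\<sigma>, \<tau>)
      \<bullet> (((\<theta> \<sigma> \<triangleleft> q \<sigma>) \<bullet> \<lbrace>q \<sigma>, \<sigma> \<rightharpoonup> g\<rbrace>) \<triangleleft> \<sigma> \<rightharpoonup> product_map p' q \<tau>)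
      \<bullet> \<sigma> \<rightharpoondown> ((\<theta> \<tau> \<triangleleft> q \<tau>) \<bullet> \<lbrace>q \<tau>, \<tau> \<rightharpoonup> g\<rbrace>)
    = (\<theta> (\<sigma> \<star> \<tau>) \<triangleleft> q (\<sigma> \<star> \<tau>)) \<bullet> \<lbrace>q (\<sigma> \<star> \<tau>), (\<sigma> \<star> \<tau>) \<rightharpoonup> g\<rbrace>
      \<bullet> (product_twist p \<epsilon> q \<eta> (\<sigma>, \<tau>) \<triangleleft> \<sigma> \<rightharpoonup> \<tau> \<rightharpoonup> g)"
    if "\<sigma> \<in> \<Gamma>" "\<tau> \<in> \<Gamma>" for \<sigma> \<tau>
    using that D iso_product_right[of "\<sigma> \<rightharpoonup> g" "\<sigma> \<rightharpoonup> \<tau> \<rightharpoonup> g" "\<sigma> \<rightharpoonup> p \<tau>" "\<sigma> \<rightharpoonup> p' \<tau>"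
      "q \<sigma>" "\<sigma> \<rightharpoonup> q \<tau>" "q (\<sigma> \<star> \<tau>)" "\<epsilon> (\<sigma>, \<tau>)" "\<epsilon>' (\<sigma>, \<tau>)" "\<eta> (\<sigma>, \<tau>)"
      "\<theta> (\<sigma> \<star> \<tau>)" "\<sigma> \<rightharpoondown> \<theta> \<tau>" "\<theta> \<sigma>"]
      iso_viaD(4)[OF iso that] iso_via_bd_lact[OF iso that] twisted_mapD(7)[OF T(3) that]
    by simp
  ultimately show ?thesis
    using D by (simp add: iso_via_def)
qed

text \<open>The new arrow is
  \<open>q(\<sigma>) \<cdot> p'(\<sigma>) \<rightarrow> q(\<sigma>) \<cdot> g\<inverse> \<cdot> p(\<sigma>) \<cdot> \<^sup>\<sigma>g \<rightarrow> g\<inverse> \<cdot> q(\<sigma>) \<cdot> p(\<sigma>) \<cdot> \<^sup>\<sigma>g\<close>.\<close>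

lemma iso_via_product_left:
  assumes T: "twisted_map p \<epsilon>" "twisted_map p' \<epsilon>'" "twisted_map q \<eta>"
    and iso: "iso_via p \<epsilon> p' \<epsilon>' g \<theta>"
  shows "iso_via (product_map q p) (product_twist q \<eta> p \<epsilon>)
    (product_map q p') (product_twist q \<eta> p' \<epsilon>') g
    (\<lambda>\<sigma>. \<theta> \<sigma> \<bullet> (\<lbrace>inv0 g, q \<sigma>\<rbrace> \<triangleleft> (p \<sigma> \<cdot> \<sigma> \<rightharpoonup> g)))"
proof -
  note D = twisted_mapD(3,4)[OF T(1)] twisted_mapD(3,4)[OF T(2)] twisted_mapD(3,4)[OF T(3)]
    iso_viaD(1,2)[OF iso]
  have bd: "q \<sigma> \<cdot> p' \<sigma> \<cdot> \<partial> (\<theta> \<sigma> \<bullet> (\<lbrace>inv0 g, q \<sigma>\<rbrace> \<triangleleft> (p \<sigma> \<cdot> \<sigma> \<rightharpoonup> g)))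
      = inv0 g \<cdot> (q \<sigma> \<cdot> p \<sigma>) \<cdot> \<sigma> \<rightharpoonup> g"
    if "\<sigma> \<in> \<Gamma>" for \<sigma>
  proof -
    have "q \<sigma> \<cdot> p' \<sigma> \<cdot> \<partial> (\<theta> \<sigma> \<bullet> (\<lbrace>inv0 g, q \<sigma>\<rbrace> \<triangleleft> (p \<sigma> \<cdot> \<sigma> \<rightharpoonup> g)))
        = q \<sigma> \<cdot> (p' \<sigma> \<cdot> \<partial> (\<theta> \<sigma>)) \<cdot> \<partial> (\<lbrace>inv0 g, q \<sigma>\<rbrace> \<triangleleft> (p \<sigma> \<cdot> \<sigma> \<rightharpoonup> g))"
      using that D by (simp add: K0.m_assoc)
    then show ?thesis
      unfolding iso_viaD(3)[OF iso that] using that D by (simp add: bd_ract bd_braid word_simps)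
  qed
  moreover have "product_twist q \<eta> p' \<epsilon>' (\<sigma>, \<tau>)
      \<bullet> ((\<theta> \<sigma> \<bullet> (\<lbrace>inv0 g, q \<sigma>\<rbrace> \<triangleleft> (p \<sigma> \<cdot> \<sigma> \<rightharpoonup> g))) \<triangleleft> \<sigma> \<rightharpoonup> product_map q p' \<tau>)
      \<bullet> \<sigma> \<rightharpoondown> (\<theta> \<tau> \<bullet> (\<lbrace>inv0 g, q \<tau>\<rbrace> \<triangleleft> (p \<tau> \<cdot> \<tau> \<rightharpoonup> g)))
    = \<theta> (\<sigma> \<star> \<tau>) \<bullet> (\<lbrace>inv0 g, q (\<sigma> \<star> \<tau>)\<rbrace> \<triangleleft> (p (\<sigma> \<star> \<tau>) \<cdot> (\<sigma> \<star> \<tau>) \<rightharpoonup> g))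
      \<bullet> (product_twist q \<eta> p \<epsilon> (\<sigma>, \<tau>) \<triangleleft> \<sigma> \<rightharpoonup> \<tau> \<rightharpoonup> g)"
    if "\<sigma> \<in> \<Gamma>" "\<tau> \<in> \<Gamma>" for \<sigma> \<tau>
    using that D iso_product_left[of "\<sigma> \<rightharpoonup> g" "\<sigma> \<rightharpoonup> \<tau> \<rightharpoonup> g" "inv0 g"
      "p \<sigma>" "\<sigma> \<rightharpoonup> p \<tau>" "p (\<sigma> \<star> \<tau>)" "p' \<sigma>" "\<sigma> \<rightharpoonup> p' \<tau>" "p' (\<sigma> \<star> \<tau>)"
      "q \<sigma>" "\<sigma> \<rightharpoonup> q \<tau>" "q (\<sigma> \<star> \<tau>)" "\<epsilon> (\<sigma>, \<tau>)" "\<epsilon>' (\<sigma>, \<tau>)" "\<eta> (\<sigma>, \<tau>)"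
      "\<theta> (\<sigma> \<star> \<tau>)" "\<sigma> \<rightharpoondown> \<theta> \<tau>" "\<theta> \<sigma>"]
      iso_viaD(4)[OF iso that] iso_via_bd_lact[OF iso that] iso_viaD(3)[OF iso that(1)]
      iso_viaD(3)[OF iso, of "\<sigma> \<star> \<tau>"] twisted_mapD(7)[OF T(1) that] twisted_mapD(7)[OF T(3) that]
    by simp
  ultimately show ?thesis
    using D by (simp add: iso_via_def)
qed

lemma Z1_class_mult_cong:
  assumes z: "(z, z') \<in> Z1_iso X" and w: "(w, w') \<in> Z1_iso X"
  shows "Z1_class X (z \<otimes>\<^bsub>Z1 X\<^esub> w) = Z1_class X (z' \<otimes>\<^bsub>Z1 X\<^esub> w')"
proof -
  obtain p \<epsilon> p' \<epsilon>' g \<theta> where 1: "z = (p, \<epsilon>)" "z' = (p', \<epsilon>')"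
    "twisted_map p \<epsilon>" "twisted_map p' \<epsilon>'" "iso_via p \<epsilon> p' \<epsilon>' g \<theta>"
    using z by (rule Z1_iso_cases)
  obtain q \<eta> q' \<eta>' h \<phi> where 2: "w = (q, \<eta>)" "w' = (q', \<eta>')"
    "twisted_map q \<eta>" "twisted_map q' \<eta>'" "iso_via q \<eta> q' \<eta>' h \<phi>"
    using w by (rule Z1_iso_cases)
  note closed = Z1_iso_closed[OF z] Z1_iso_closed[OF w]
  have "(z \<otimes>\<^bsub>Z1 X\<^esub> w, z' \<otimes>\<^bsub>Z1 X\<^esub> w) \<in> Z1_iso X"
    using iso_via_product_right[OF 1(3,4) 2(3) 1(5)] Z1_mult_closed[of z w] Z1_mult_closed[of z' w]
      closed by (auto simp: 1(1,2) 2(1) Z1_simps Z1_iso_iff)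
  moreover have "(z' \<otimes>\<^bsub>Z1 X\<^esub> w, z' \<otimes>\<^bsub>Z1 X\<^esub> w') \<in> Z1_iso X"
    using iso_via_product_left[OF 2(3,4) 1(4) 2(5)] Z1_mult_closed[of z' w] Z1_mult_closed[of z' w']
      closed by (auto simp: 1(2) 2(1,2) Z1_simps Z1_iso_iff)
  ultimately show ?thesis
    by (simp add: Z1_class_eq)
qed

lemma H1_mult_class:
  assumes "z \<in> Z1_set X" "w \<in> Z1_set X"
  shows "Z1_class X z \<otimes>\<^bsub>H1 X\<^esub> Z1_class X w = Z1_class X (z \<otimes>\<^bsub>Z1 X\<^esub> w)"
proof -
  have "Z1_class X (z' \<otimes>\<^bsub>Z1 X\<^esub> w') = Z1_class X (z \<otimes>\<^bsub>Z1 X\<^esub> w)"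
    if "z' \<in> Z1_class X z" "w' \<in> Z1_class X w" for z' w'
    using that Z1_class_mult_cong[of z z' w w'] by (simp add: Z1_class_def)
  then have "(\<Union>z'\<in>Z1_class X z. \<Union>w'\<in>Z1_class X w. Z1_class X (z' \<otimes>\<^bsub>Z1 X\<^esub> w'))
      = (\<Union>z'\<in>Z1_class X z. \<Union>w'\<in>Z1_class X w. Z1_class X (z \<otimes>\<^bsub>Z1 X\<^esub> w))"
    by (intro SUP_cong refl)
  also have "\<dots> = Z1_class X (z \<otimes>\<^bsub>Z1 X\<^esub> w)"
    using Z1_class_self[OF assms(1)] Z1_class_self[OF assms(2)] by blast
  finally show ?thesis
    by (simp add: H1_def)
qed

lemma H1_carrier: "carrier (H1 X) = Z1_class X ` Z1_set X"
  by (simp add: H1_def H1_set_eq)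

lemma H1_one: "\<one>\<^bsub>H1 X\<^esub> = Z1_class X \<one>\<^bsub>Z1 X\<^esub>"
  by (simp add: H1_def)

lemma H1_group: "group (H1 X)"
proof -
  note [simp] = H1_mult_class Z1_mult_closed Z1_one_closed
  note Z1.m_assoc [unfolded Z1_simps(1), simp] Z1.l_one [unfolded Z1_simps(1), simp]
  show ?thesis
  proof (rule groupI, goal_cases)
    case (5 U)
    then obtain z where z: "z \<in> Z1_set X" "U = Z1_class X z"
      by (auto simp: H1_carrier)
    then obtain w where "w \<in> Z1_set X" "w \<otimes>\<^bsub>Z1 X\<^esub> z = \<one>\<^bsub>Z1 X\<^esub>"
      using Z1_left_inverse by blast
    with z show ?case
      by (auto simp: H1_carrier H1_one intro!: bexI[of _ w])
  qed (auto simp: H1_carrier H1_one)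
qed

end

section \<open>The action of \<open>H\<^sup>1\<close> on \<open>H\<^sup>0\<close>\<close>

context braided_crossed_module
begin

lemma C0_act_eq:
  assumes c: "(g, \<theta>) \<in> carrier (Z0 X)" and z: "twisted_map p \<epsilon>"
  shows "C0_act X (g, \<theta>) (p, \<epsilon>) = (g, \<lambda>\<sigma>\<in>\<Gamma>. monodromy (p \<sigma>) g \<bullet> \<theta> \<sigma>)"
  using Z0D(1,3,4)[OF c] twisted_mapD(3)[OF z]
  by (auto simp: C0_act_def act_eq_monodromy intro!: restrict_ext)

lemma monodromy_mult_bd:
  "\<lbrakk>g \<in> Ob; h \<in> Ob; \<alpha> \<in> Ar\<rbrakk> \<Longrightarrow> monodromy g (h \<cdot> \<partial> \<alpha>) = monodromy g h"
  "\<lbrakk>g \<in> Ob; h \<in> Ob; \<alpha> \<in> Ar\<rbrakk> \<Longrightarrow> monodromy (g \<cdot> \<partial> \<alpha>) h = monodromy g h"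
  by (simp_all add: monodromy_mult_left monodromy_mult_right)

lemma Z0_lact0:
  assumes "(g, \<theta>) \<in> carrier (Z0 X)" "\<sigma> \<in> \<Gamma>"
  shows "\<sigma> \<rightharpoonup> g = g \<cdot> \<partial> (\<theta> \<sigma>)"
  using Z0D(1,4)[OF assms(1)] assms(2) by simp

text \<open>The cocycle identity is preserved because \<open>\<sigma> \<mapsto> monodromy (p \<sigma>) g\<close> is itself a crossed
  homomorphism: monodromies do not see boundaries, so that \<open>p(\<sigma>\<tau>)\<close> may be replaced by
  \<open>p(\<sigma>) \<cdot> \<^sup>\<sigma>p(\<tau>)\<close> and \<open>g\<close> by \<open>\<^sup>\<sigma>g\<close>.\<close>

lemma C0_act_closed:
  assumes c: "(g, \<theta>) \<in> carrier (Z0 X)" and z: "twisted_map p \<epsilon>"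
  shows "C0_act X (g, \<theta>) (p, \<epsilon>) \<in> carrier (Z0 X)"
proof -
  note D = Z0D(1,3)[OF c] twisted_mapD(3,4)[OF z]
  have "monodromy (p (\<sigma> \<star> \<tau>)) g \<bullet> \<theta> (\<sigma> \<star> \<tau>)
      = monodromy (p \<sigma>) g \<bullet> \<theta> \<sigma> \<bullet> \<sigma> \<rightharpoondown> (monodromy (p \<tau>) g \<bullet> \<theta> \<tau>)"
    if G: "\<sigma> \<in> \<Gamma>" "\<tau> \<in> \<Gamma>" for \<sigma> \<tau>
  proof -
    have "monodromy (p (\<sigma> \<star> \<tau>)) g = monodromy (p (\<sigma> \<star> \<tau>) \<cdot> \<partial> (\<epsilon> (\<sigma>, \<tau>))) g"
      using G D by (simp add: monodromy_mult_bd)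
    also have "\<dots> = monodromy (p \<sigma>) g \<bullet> monodromy (\<sigma> \<rightharpoonup> p \<tau>) g"
      using G D by (simp add: twisted_mapD(7)[OF z] monodromy_mult_left)
    also have "monodromy (\<sigma> \<rightharpoonup> p \<tau>) g = monodromy (\<sigma> \<rightharpoonup> p \<tau>) (\<sigma> \<rightharpoonup> g)"
      using G D by (simp add: Z0_lact0[OF c] monodromy_mult_bd)
    also have "\<dots> = \<sigma> \<rightharpoondown> monodromy (p \<tau>) g"
      using G D by (simp add: monodromy_equivariant)
    finally have "monodromy (p (\<sigma> \<star> \<tau>)) g \<bullet> \<theta> (\<sigma> \<star> \<tau>)
        = monodromy (p \<sigma>) g \<bullet> (\<sigma> \<rightharpoondown> monodromy (p \<tau>) g \<bullet> \<theta> \<sigma>) \<bullet> \<sigma> \<rightharpoondown> \<theta> \<tau>"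
      using G D by (simp add: Z0D(5)[OF c] K1.m_assoc)
    also have "\<sigma> \<rightharpoondown> monodromy (p \<tau>) g \<bullet> \<theta> \<sigma> = \<theta> \<sigma> \<bullet> \<sigma> \<rightharpoondown> monodromy (p \<tau>) g"
      using G D by (simp add: monodromy_equivariant monodromy_central)
    finally show ?thesis
      using G D by (simp add: K1.m_assoc)
  qed
  then show ?thesis
    using D Z0D(4)[OF c] by (simp add: C0_act_eq[OF c z] Z0_iff)
qed

lemma C0_act_one:
  assumes c: "(g, \<theta>) \<in> carrier (Z0 X)"
  shows "C0_act X (g, \<theta>) \<one>\<^bsub>Z1 X\<^esub> = (g, \<theta>)"
proof -
  have "monodromy \<one>\<^sub>0 g = \<one>\<^sub>1"
    using Z0D(1)[OF c] by (simp add: monodromy_def)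
  moreover have "twisted_map (\<lambda>\<sigma>\<in>\<Gamma>. \<one>\<^sub>0) (\<lambda>_\<in>\<Gamma> \<times> \<Gamma>. \<one>\<^sub>1)"
    using Z1_one_closed by (simp add: Z1_simps Z1_set_iff)
  ultimately show ?thesis
    using Z0D[OF c] by (auto simp: Z1_simps C0_act_eq[OF c] intro!: extensionalityI[where A = \<Gamma>])
qed

lemma C0_act_mult:
  assumes c: "(g, \<theta>) \<in> carrier (Z0 X)" and z: "twisted_map p \<epsilon>" and w: "twisted_map q \<eta>"
  shows "C0_act X (g, \<theta>) ((p, \<epsilon>) \<otimes>\<^bsub>Z1 X\<^esub> (q, \<eta>)) = C0_act X (C0_act X (g, \<theta>) (p, \<epsilon>)) (q, \<eta>)"
proof -
  have "monodromy (p \<sigma> \<cdot> q \<sigma>) g \<bullet> \<theta> \<sigma> = monodromy (q \<sigma>) g \<bullet> (monodromy (p \<sigma>) g \<bullet> \<theta> \<sigma>)"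
    if "\<sigma> \<in> \<Gamma>" for \<sigma>
  proof -
    note D = Z0D(1,3)[OF c] twisted_mapD(3)[OF z] twisted_mapD(3)[OF w]
    have "monodromy (p \<sigma> \<cdot> q \<sigma>) g = monodromy (q \<sigma>) g \<bullet> monodromy (p \<sigma>) g"
      using that D monodromy_central[of "p \<sigma>" g "monodromy (q \<sigma>) g"]
      by (simp add: monodromy_mult_left)
    then show ?thesis
      using that D by (simp add: K1.m_assoc)
  qed
  then show ?thesis
    using C0_act_eq[OF C0_act_closed[OF c z, unfolded C0_act_eq[OF c z]] w]
    by (auto simp: Z1_simps C0_act_eq[OF c z] C0_act_eq[OF c twisted_map_product[OF z w]]
        intro!: restrict_ext)
qed

lemma C0_act_distrib:
  assumes c: "(g, \<theta>) \<in> carrier (Z0 X)" and d: "(h, \<phi>) \<in> carrier (Z0 X)" and z: "twisted_map p \<epsilon>"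
  shows "C0_act X ((g, \<theta>) \<otimes>\<^bsub>Z0 X\<^esub> (h, \<phi>)) (p, \<epsilon>)
    = C0_act X (g, \<theta>) (p, \<epsilon>) \<otimes>\<^bsub>Z0 X\<^esub> C0_act X (h, \<phi>) (p, \<epsilon>)"
proof -
  note D = Z0D(1,3)[OF c] Z0D(1,3)[OF d] twisted_mapD(3)[OF z]
  have "monodromy (p \<sigma>) (g \<cdot> h) \<bullet> ((\<theta> \<sigma> \<triangleleft> h) \<bullet> \<phi> \<sigma>)
      = ((monodromy (p \<sigma>) g \<bullet> \<theta> \<sigma>) \<triangleleft> h) \<bullet> (monodromy (p \<sigma>) h \<bullet> \<phi> \<sigma>)" if "\<sigma> \<in> \<Gamma>" for \<sigma>
  proof -
    have "monodromy (p \<sigma>) (g \<cdot> h) \<bullet> ((\<theta> \<sigma> \<triangleleft> h) \<bullet> \<phi> \<sigma>)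
        = monodromy (p \<sigma>) g \<bullet> (monodromy (p \<sigma>) h \<bullet> (\<theta> \<sigma> \<triangleleft> h)) \<bullet> \<phi> \<sigma>"
      using that D by (simp add: monodromy_mult_right K1.m_assoc)
    also have "monodromy (p \<sigma>) h \<bullet> (\<theta> \<sigma> \<triangleleft> h) = (\<theta> \<sigma> \<triangleleft> h) \<bullet> monodromy (p \<sigma>) h"
      using that D by (simp add: monodromy_central)
    finally show ?thesis
      using that D by (simp add: word_simps)
  qed
  then show ?thesis
    using C0_act_eq[OF Z0_mult_closed[OF c d, unfolded Z0_mult] z]
    by (auto simp: Z0_mult C0_act_eq[OF c z] C0_act_eq[OF d z] intro!: restrict_ext)
qed

lemma C0_act_coboundary:
  assumes "\<mu> \<in> Ar" and z: "twisted_map p \<epsilon>"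
  shows "C0_act X (coboundary \<mu>) (p, \<epsilon>) = coboundary \<mu>"
  using C0_act_eq[OF coboundary_closed[OF assms(1), unfolded coboundary_def] z]
    assms(1) twisted_mapD(3)[OF z]
  by (auto simp: coboundary_def intro!: restrict_ext)

text \<open>Modulo boundaries \<open>q(\<sigma>)\<close> is \<open>g\<inverse> \<cdot> p(\<sigma>) \<cdot> \<^sup>\<sigma>g\<close>, so its monodromy with \<open>h\<close> is that of
  \<open>p(\<sigma>)\<close> multiplied by \<open>s\<inverse> \<cdot> \<^sup>\<sigma>s\<close> for \<open>s = monodromy g h\<close>.\<close>

lemma C0_act_iso:
  assumes c: "(h, \<phi>) \<in> carrier (Z0 X)" and T: "twisted_map p \<epsilon>" "twisted_map q \<eta>"
    and iso: "iso_via p \<epsilon> q \<eta> g \<theta>"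
  shows "C0_act X (h, \<phi>) (q, \<eta>) = C0_act X (h, \<phi>) (p, \<epsilon>) \<otimes>\<^bsub>Z0 X\<^esub> coboundary (monodromy g h)"
proof -
  note D = Z0D(1,3)[OF c] twisted_mapD(3)[OF T(1)] twisted_mapD(3)[OF T(2)] iso_viaD(1,2)[OF iso]
  let ?s = "monodromy g h"
  have "monodromy (q \<sigma>) h \<bullet> \<phi> \<sigma>
      = (monodromy (p \<sigma>) h \<bullet> \<phi> \<sigma>) \<bullet> (inv1 ?s \<bullet> \<sigma> \<rightharpoondown> ?s)" if G: "\<sigma> \<in> \<Gamma>" for \<sigma>
  proof -
    have "monodromy (q \<sigma>) h = monodromy (q \<sigma> \<cdot> \<partial> (\<theta> \<sigma>)) h"
      using G D by (simp add: monodromy_mult_bd)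
    also have "\<dots> = inv1 ?s \<bullet> monodromy (p \<sigma>) h \<bullet> monodromy (\<sigma> \<rightharpoonup> g) h"
      using G D by (simp add: iso_viaD(3)[OF iso] monodromy_mult_left monodromy_inv_left)
    also have "monodromy (\<sigma> \<rightharpoonup> g) h = monodromy (\<sigma> \<rightharpoonup> g) (\<sigma> \<rightharpoonup> h)"
      using G D by (simp add: Z0_lact0[OF c] monodromy_mult_bd)
    also have "\<dots> = \<sigma> \<rightharpoondown> ?s"
      using G D by (simp add: monodromy_equivariant)
    also have "inv1 ?s \<bullet> monodromy (p \<sigma>) h = monodromy (p \<sigma>) h \<bullet> inv1 ?s"
      using G D by (simp add: monodromy_central)
    finally have "monodromy (q \<sigma>) h \<bullet> \<phi> \<sigma>
        = monodromy (p \<sigma>) h \<bullet> ((inv1 ?s \<bullet> \<sigma> \<rightharpoondown> ?s) \<bullet> \<phi> \<sigma>)"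
      using G D by (simp add: K1.m_assoc)
    also have "(inv1 ?s \<bullet> \<sigma> \<rightharpoondown> ?s) \<bullet> \<phi> \<sigma> = \<phi> \<sigma> \<bullet> (inv1 ?s \<bullet> \<sigma> \<rightharpoondown> ?s)"
      using G D kernel_central[of "inv1 ?s \<bullet> \<sigma> \<rightharpoondown> ?s" "\<phi> \<sigma>"] by simp
    finally show ?thesis
      using G D by (simp add: K1.m_assoc)
  qed
  then show ?thesis
    using D by (auto simp: C0_act_eq[OF c T(1)] C0_act_eq[OF c T(2)] coboundary_def Z0_mult
        intro!: restrict_ext)
qed

lemma Z0_cases:
  assumes "c \<in> carrier (Z0 X)"
  obtains g \<theta> where "c = (g, \<theta>)" "(g, \<theta>) \<in> carrier (Z0 X)"
  using assms by (cases c) auto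

lemma C0_act_Z0:
  assumes "c \<in> carrier (Z0 X)" "z \<in> Z1_set X"
  shows "C0_act X c z \<in> carrier (Z0 X)"
  using assms by (metis Z0_cases Z1_set_cases C0_act_closed)

text \<open>Coboundaries are fixed by the action, so changing \<open>c\<close> within its coset multiplies the
  result by a coboundary; changing \<open>z\<close> within its class does so by \<open>C0_act_iso\<close>.\<close>

lemma B0_coset_C0_act_cong:
  assumes c: "c' \<in> B0 X #>\<^bsub>Z0 X\<^esub> c" "c \<in> carrier (Z0 X)" and z: "(z, z') \<in> Z1_iso X"
  shows "B0 X #>\<^bsub>Z0 X\<^esub> C0_act X c' z' = B0 X #>\<^bsub>Z0 X\<^esub> C0_act X c z"
proof -
  obtain p \<epsilon> q \<eta> g \<theta> where 1: "z = (p, \<epsilon>)" "z' = (q, \<eta>)" "twisted_map p \<epsilon>" "twisted_map q \<eta>"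
    "iso_via p \<epsilon> q \<eta> g \<theta>"
    using z by (rule Z1_iso_cases)
  obtain h \<phi> where h: "c = (h, \<phi>)" "(h, \<phi>) \<in> carrier (Z0 X)"
    using c(2) by (rule Z0_cases)
  obtain \<mu> where \<mu>: "\<mu> \<in> Ar" "c' = coboundary \<mu> \<otimes>\<^bsub>Z0 X\<^esub> c"
    using c(1) by (auto simp: r_coset_def B0_eq)
  have q: "C0_act X c (q, \<eta>) \<in> carrier (Z0 X)" and p: "C0_act X c (p, \<epsilon>) \<in> carrier (Z0 X)"
    using C0_act_closed[OF h(2) 1(4)] C0_act_closed[OF h(2) 1(3)] by (simp_all add: h(1))
  have "C0_act X c' z' = C0_act X (coboundary \<mu>) (q, \<eta>) \<otimes>\<^bsub>Z0 X\<^esub> C0_act X c (q, \<eta>)"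
    using C0_act_distrib[OF _ h(2) 1(4)] coboundary_closed[OF \<mu>(1)]
    by (simp add: \<mu>(2) 1(2) h(1) coboundary_def)
  then have "C0_act X c' z' = coboundary \<mu> \<otimes>\<^bsub>Z0 X\<^esub> C0_act X c (q, \<eta>)"
    using C0_act_coboundary[OF \<mu>(1) 1(4)] by simp
  then have "C0_act X c' z' \<in> B0 X #>\<^bsub>Z0 X\<^esub> C0_act X c (q, \<eta>)"
    using \<mu>(1) by (auto simp: r_coset_def B0_eq)
  from Z0.repr_independence[OF this q B0_subgroup]
  have "B0 X #>\<^bsub>Z0 X\<^esub> C0_act X c' z' = B0 X #>\<^bsub>Z0 X\<^esub> C0_act X c (q, \<eta>)" ..
  also have "\<dots> = B0 X #>\<^bsub>Z0 X\<^esub> C0_act X c z"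
    using C0_act_iso[OF h(2) 1(3-5)] p Z0D(1)[OF h(2)] iso_viaD(1)[OF 1(5)]
    by (simp add: h(1) 1(1) B0_coset_mult_coboundary)
  finally show ?thesis .
qed

lemma H0_act_class:
  assumes c: "c \<in> carrier (Z0 X)" and z: "z \<in> Z1_set X"
  shows "H0_act X (B0 X #>\<^bsub>Z0 X\<^esub> c) (Z1_class X z) = B0 X #>\<^bsub>Z0 X\<^esub> C0_act X c z"
proof -
  have "H0_act X (B0 X #>\<^bsub>Z0 X\<^esub> c) (Z1_class X z)
      = (\<Union>c'\<in>B0 X #>\<^bsub>Z0 X\<^esub> c. \<Union>z'\<in>Z1_class X z. B0 X #>\<^bsub>Z0 X\<^esub> C0_act X c z)"
    unfolding H0_act_def
    by (intro SUP_cong refl B0_coset_C0_act_cong c) (auto simp: Z1_class_def)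
  also have "\<dots> = B0 X #>\<^bsub>Z0 X\<^esub> C0_act X c z"
    using Z1_class_self[OF z] Z0.rcos_self[OF c B0_subgroup] by blast
  finally show ?thesis .
qed

lemma H0_simps:
  "carrier (H0 X) = (\<lambda>c. B0 X #>\<^bsub>Z0 X\<^esub> c) ` carrier (Z0 X)"
  "\<lbrakk>c \<in> carrier (Z0 X); d \<in> carrier (Z0 X)\<rbrakk>
    \<Longrightarrow> (B0 X #>\<^bsub>Z0 X\<^esub> c) \<otimes>\<^bsub>H0 X\<^esub> (B0 X #>\<^bsub>Z0 X\<^esub> d) = B0 X #>\<^bsub>Z0 X\<^esub> (c \<otimes>\<^bsub>Z0 X\<^esub> d)"
  by (simp_all add: H0_def carrier_FactGroup B0.rcos_sum)

lemma H0_right_aut_action: "right_aut_action (H1 X) (H0 X) (H0_act X)"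
proof (intro right_aut_action.intro right_aut_action_axioms.intro H1_group)
  show "group (H0 X)"
    using H0_comm_group by (simp add: comm_group_def)
next
  fix A U assume "A \<in> carrier (H0 X)" "U \<in> carrier (H1 X)"
  then show "H0_act X A U \<in> carrier (H0 X)"
    by (auto simp: H0_simps(1) H1_carrier H0_act_class C0_act_Z0)
next
  fix A assume "A \<in> carrier (H0 X)"
  then obtain c where c: "c \<in> carrier (Z0 X)" "A = B0 X #>\<^bsub>Z0 X\<^esub> c"
    by (auto simp: H0_simps(1))
  moreover have "C0_act X c \<one>\<^bsub>Z1 X\<^esub> = c"
    using c(1) by (metis Z0_cases C0_act_one)
  ultimately show "H0_act X A \<one>\<^bsub>H1 X\<^esub> = A"
    by (simp add: H1_one H0_act_class Z1_one_closed)
next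
  fix A U V assume "A \<in> carrier (H0 X)" "U \<in> carrier (H1 X)" "V \<in> carrier (H1 X)"
  then obtain c z w where *: "c \<in> carrier (Z0 X)" "z \<in> Z1_set X" "w \<in> Z1_set X"
    "A = B0 X #>\<^bsub>Z0 X\<^esub> c" "U = Z1_class X z" "V = Z1_class X w"
    by (auto simp: H0_simps(1) H1_carrier)
  have "C0_act X c (z \<otimes>\<^bsub>Z1 X\<^esub> w) = C0_act X (C0_act X c z) w"
    using *(1-3) by (metis Z0_cases Z1_set_cases C0_act_mult)
  then show "H0_act X A (U \<otimes>\<^bsub>H1 X\<^esub> V) = H0_act X (H0_act X A U) V"
    using * by (simp add: H1_mult_class H0_act_class Z1_mult_closed C0_act_Z0)
next
  fix A B U assume "A \<in> carrier (H0 X)" "B \<in> carrier (H0 X)" "U \<in> carrier (H1 X)"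
  then obtain c d z where *: "c \<in> carrier (Z0 X)" "d \<in> carrier (Z0 X)" "z \<in> Z1_set X"
    "A = B0 X #>\<^bsub>Z0 X\<^esub> c" "B = B0 X #>\<^bsub>Z0 X\<^esub> d" "U = Z1_class X z"
    by (auto simp: H0_simps(1) H1_carrier)
  have "C0_act X (c \<otimes>\<^bsub>Z0 X\<^esub> d) z = C0_act X c z \<otimes>\<^bsub>Z0 X\<^esub> C0_act X d z"
    using *(1-3) by (metis Z0_cases Z1_set_cases C0_act_distrib)
  then show "H0_act X (A \<otimes>\<^bsub>H0 X\<^esub> B) U = H0_act X A U \<otimes>\<^bsub>H0 X\<^esub> H0_act X B U"
    using * by (simp add: H0_simps(2) H0_act_class C0_act_Z0)
qed

end

theorem corollary4p2:
  fixes X :: "('a, 'b, 's) braided_crossed_module"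
  assumes "braided_crossed_module X"
  shows "group (H1 X)
    \<and> (\<forall>z\<in>carrier (Z1 X). \<forall>w\<in>carrier (Z1 X).
        Z1_class X z \<otimes>\<^bsub>H1 X\<^esub> Z1_class X w = Z1_class X (z \<otimes>\<^bsub>Z1 X\<^esub> w))
    \<and> comm_group (H0 X)
    \<and> right_aut_action (H1 X) (H0 X) (H0_act X)
    \<and> (\<forall>c\<in>carrier (Z0 X). \<forall>z\<in>carrier (Z1 X).
        C0_act X c z \<in> carrier (Z0 X)
        \<and> H0_act X (B0 X #>\<^bsub>Z0 X\<^esub> c) (Z1_class X z) = B0 X #>\<^bsub>Z0 X\<^esub> C0_act X c z)"
proof -
  interpret braided_crossed_module X
    by (rule assms)
  show ?thesis
    using H1_group H0_comm_group H0_right_aut_action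
    by (simp add: Z1_simps(1) H1_mult_class C0_act_Z0 H0_act_class)
qed

end
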